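(* Let $T>0$ and let $\lambda,G,F,\beta,r_0$ be as in the context. Any solution $(\rho,\eta,d,z^1,z^2,z^3)$ of system (S) of the context satisfies (for a.e. $t\in[0,T]$) $$\begin{cases} z^1(t)=1,\ z^2(t)d(t)=0,\ z^3(t)=1, & \rho_t<1,\ \eta_t=0,\\ z^1(t)\lambda(t)+z^2(t)d(t)=\lambda(t),\ z^3(t)=1, & \rho_t=1,\ \eta_t=0,\\ z^1(t)\lambda(t)=0,\ z^2(t)=1,\ z^3(t)=1, & \rho_t=1,\ 0<\eta_t<\beta,\\ z^1(t)\lambda(t)=0,\ z^2(t)=1,\ z^3(t)\lambda(t)=d(t), & \rho_t=1,\ \eta_t=\beta.\end{cases}$$ In particular, the tuple $(\rho,\eta,d,z^1,z^2,z^3)$ satisfying the three integral equations (S1)–(S3) and the bounds (S4) of the context together with $$\begin{cases} z^1(t)=1,\ z^2(t)=0,\ z^3(t)=1, & \rho_t<1,\ \eta_t=0,\\ z^1(t)=1,\ z^2(t)=0,\ z^3(t)=1, & \rho_t=1,\ \eta_t=0,\\ z^1(t)=0,\ z^2(t)=1,\ z^3(t)=1, & \rho_t=1,\ 0<\eta_t<\beta,\\ z^1(t)=0,\ z^2(t)=1,\ z^3(t)=\frac{d(t)}{\lambda(t)}\wedge1, & \rho_t=1,\ \eta_t=\beta,\end{cases}$$ is a solution of system (S). Moreover, the functions $z^1\lambda+z^2d$ and $z^3\lambda$ are unique almost everywhere on $[0,T]$.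
   Context: $\lambda:[0,\infty)\to[0,\infty)$ is locally integrable; $G$ is a probability distribution function on $[0,\infty)$ with density $g$ bounded by a constant $c_g>0$, $\bar G=1-G$; $\beta\in[0,\infty)$; $r_0\in(0,1+\beta]$; $F$ is a probability distribution function on $[0,\infty)$ with density $f$, $\bar F=1-F$. (Data of a sequence of $M_t/G/n/(n+b_n)$ queues with arrival rate $n\lambda$, service distribution $G$, $b_n/n\to\beta$, scaled initial number in system converging to $r_0$, and limiting remaining-service distribution $F$ of initially busy servers.) System (S) for $(\rho,\eta,d,z^1,z^2,z^3)$ on $[0,T]$, with $D_t=\int_0^td(u)du$, consists of: for all $t\in[0,T]$ (S1) $\rho_t=\min\{r_0,1\}\bar F(t)+\int_0^t z^1(u)\bar G(t-u)\lambda(u)du+\int_0^t z^2(u)\bar G(t-u)d(u)du$; (S2) $\eta_t=\max\{r_0-1,0\}+\int_0^t(1-z^1(u))z^3(u)\lambda(u)du-\int_0^tz^2(u)d(u)du$; (S3) $D_t=\min\{r_0,1\}F(t)+\int_0^tz^1(u)G(t-u)\lambda(u)du+\int_0^tz^2(u)G(t-u)d(u)du$; and for almost every $t\in[0,T]$ (S4) $\mathbb 1_{\{\rho_t<1\}}\le z^1(t)\le1$, $\ \mathbb 1_{\{\eta_t>0\}}\le z^2(t)\le1$, $\ \mathbb 1_{\{\eta_t<\beta\}}\le z^3(t)\le1$; (S5) $0\le\rho_t\le1$, $\ 0\le\eta_t\le\beta$, $\ \eta_t(1-\rho_t)=0$. There is a unique $(\rho,\eta,d)$ ($d$ up to a.e.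 equality) for which some $(z^1,z^2,z^3)$ makes (S) hold.
   Formalization: For β=0 condition (S4) leaves z³ free where ρ<1 (e.g. λ=1, r₀=1/2, exponential G, F), so the first table and uniqueness of z³λ fail; both are stated for β>0 only. For β=0 only z¹=1, z²d=0 of row one is kept from the table. *)

theory Defs
  imports "HOL-Probability.Probability"
begin

definition cdf_with_density :: "(real \<Rightarrow> real) \<Rightarrow> (real \<Rightarrow> real) \<Rightarrow> bool" where
  "cdf_with_density G g \<longleftrightarrow>
     g \<in> borel_measurable borel \<and> (\<forall>x. 0 \<le> g x) \<and> (\<forall>x<0. g x = 0) \<and>
     prob_space (density lborel (\<lambda>x. ennreal (g x))) \<and>
     G = cdf (density lborel (\<lambda>x. ennreal (g x)))"

definition locally_integrable_nonneg :: "(real \<Rightarrow> real) \<Rightarrow> bool" where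
  "locally_integrable_nonneg lam \<longleftrightarrow>
     (\<forall>u\<ge>0. 0 \<le> lam u) \<and> (\<forall>t\<ge>0. set_integrable lebesgue {0..t} lam)"

(* The regularity that is implicit in writing the integrals of the system.  Together with
   control_bounds it makes all integrands below integrable, so that no integral takes the
   default value 0.  Nonnegativity of d is not required. *)
definition regular_controls ::
  "real \<Rightarrow> (real \<Rightarrow> real) \<Rightarrow> (real \<Rightarrow> real) \<Rightarrow> (real \<Rightarrow> real) \<Rightarrow> (real \<Rightarrow> real) \<Rightarrow> bool" where
  "regular_controls T d z1 z2 z3 \<longleftrightarrow>
     set_integrable lebesgue {0..T} d \<and>
     set_borel_measurable lebesgue {0..T} z1 \<and>
     set_borel_measurable lebesgue {0..T} z2 \<and>
     set_borel_measurable lebesgue {0..T} z3"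

definition integral_equations ::
  "(real \<Rightarrow> real) \<Rightarrow> (real \<Rightarrow> real) \<Rightarrow> (real \<Rightarrow> real) \<Rightarrow> real \<Rightarrow> real \<Rightarrow>
   (real \<Rightarrow> real) \<Rightarrow> (real \<Rightarrow> real) \<Rightarrow> (real \<Rightarrow> real) \<Rightarrow>
   (real \<Rightarrow> real) \<Rightarrow> (real \<Rightarrow> real) \<Rightarrow> (real \<Rightarrow> real) \<Rightarrow> bool" where
  "integral_equations lam G F r0 T \<rho> \<eta> d z1 z2 z3 \<longleftrightarrow> (\<forall>t\<in>{0..T}.
     \<rho> t = min r0 1 * (1 - F t)
         + (LINT u:{0..t}|lebesgue. z1 u * (1 - G (t - u)) * lam u)
         + (LINT u:{0..t}|lebesgue. z2 u * (1 - G (t - u)) * d u) \<and>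
     \<eta> t = max (r0 - 1) 0
         + (LINT u:{0..t}|lebesgue. (1 - z1 u) * z3 u * lam u)
         - (LINT u:{0..t}|lebesgue. z2 u * d u) \<and>
     (LINT u:{0..t}|lebesgue. d u) = min r0 1 * F t
         + (LINT u:{0..t}|lebesgue. z1 u * G (t - u) * lam u)
         + (LINT u:{0..t}|lebesgue. z2 u * G (t - u) * d u))"

definition control_bounds ::
  "real \<Rightarrow> real \<Rightarrow> (real \<Rightarrow> real) \<Rightarrow> (real \<Rightarrow> real) \<Rightarrow>
   (real \<Rightarrow> real) \<Rightarrow> (real \<Rightarrow> real) \<Rightarrow> (real \<Rightarrow> real) \<Rightarrow> bool" where
  "control_bounds \<beta> T \<rho> \<eta> z1 z2 z3 \<longleftrightarrow> (AE t\<in>{0..T} in lebesgue.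
     of_bool (\<rho> t < 1) \<le> z1 t \<and> z1 t \<le> 1 \<and>
     of_bool (\<eta> t > 0) \<le> z2 t \<and> z2 t \<le> 1 \<and>
     of_bool (\<eta> t < \<beta>) \<le> z3 t \<and> z3 t \<le> 1)"

definition state_constraints ::
  "real \<Rightarrow> real \<Rightarrow> (real \<Rightarrow> real) \<Rightarrow> (real \<Rightarrow> real) \<Rightarrow> bool" where
  "state_constraints \<beta> T \<rho> \<eta> \<longleftrightarrow> (AE t\<in>{0..T} in lebesgue.
     0 \<le> \<rho> t \<and> \<rho> t \<le> 1 \<and> 0 \<le> \<eta> t \<and> \<eta> t \<le> \<beta> \<and> \<eta> t * (1 - \<rho> t) = 0)"

definition fluid_solution ::
  "(real \<Rightarrow> real) \<Rightarrow> (real \<Rightarrow> real) \<Rightarrow> (real \<Rightarrow> real) \<Rightarrow> real \<Rightarrow> real \<Rightarrow> real \<Rightarrow>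
   (real \<Rightarrow> real) \<Rightarrow> (real \<Rightarrow> real) \<Rightarrow> (real \<Rightarrow> real) \<Rightarrow>
   (real \<Rightarrow> real) \<Rightarrow> (real \<Rightarrow> real) \<Rightarrow> (real \<Rightarrow> real) \<Rightarrow> bool" where
  "fluid_solution lam G F \<beta> r0 T \<rho> \<eta> d z1 z2 z3 \<longleftrightarrow>
     regular_controls T d z1 z2 z3 \<and>
     integral_equations lam G F r0 T \<rho> \<eta> d z1 z2 z3 \<and>
     control_bounds \<beta> T \<rho> \<eta> z1 z2 z3 \<and>
     state_constraints \<beta> T \<rho> \<eta>"

(* The two case tables below are pointwise, with all arguments being values at one time t.
   Each is a disjunction "case condition and prescribed values", so it includes that
   (\<rho>, \<eta>) lies in one of the four cases.  The conditions are mutually exclusive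
   if \<beta> > 0; for \<beta> = 0 the second and the fourth coincide. *)

definition case_table ::
  "real \<Rightarrow> real \<Rightarrow> real \<Rightarrow> real \<Rightarrow> real \<Rightarrow> real \<Rightarrow> real \<Rightarrow> real \<Rightarrow> bool" where
  "case_table \<beta> l r e d z1 z2 z3 \<longleftrightarrow>
     (r < 1 \<and> e = 0 \<and> z1 = 1 \<and> z2 * d = 0 \<and> z3 = 1) \<or>
     (r = 1 \<and> e = 0 \<and> z1 * l + z2 * d = l \<and> z3 = 1) \<or>
     (r = 1 \<and> 0 < e \<and> e < \<beta> \<and> z1 * l = 0 \<and> z2 = 1 \<and> z3 = 1) \<or>
     (r = 1 \<and> e = \<beta> \<and> z1 * l = 0 \<and> z2 = 1 \<and> z3 * l = d)"

(* In the last case the value of d / l at l = 0 is a matter of convention (and irrelevant,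
   since z3 enters the system only through z3 * l), so z3 is left free there. *)
definition canonical_case_table ::
  "real \<Rightarrow> real \<Rightarrow> real \<Rightarrow> real \<Rightarrow> real \<Rightarrow> real \<Rightarrow> real \<Rightarrow> real \<Rightarrow> bool" where
  "canonical_case_table \<beta> l r e d z1 z2 z3 \<longleftrightarrow>
     (r < 1 \<and> e = 0 \<and> z1 = 1 \<and> z2 = 0 \<and> z3 = 1) \<or>
     (r = 1 \<and> e = 0 \<and> z1 = 1 \<and> z2 = 0 \<and> z3 = 1) \<or>
     (r = 1 \<and> 0 < e \<and> e < \<beta> \<and> z1 = 0 \<and> z2 = 1 \<and> z3 = 1) \<or>
     (r = 1 \<and> e = \<beta> \<and> z1 = 0 \<and> z2 = 1 \<and> (l \<noteq> 0 \<longrightarrow> z3 = min (d / l) 1))"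

end

theory Submission
  imports Defs
begin

text \<open>
  With \<open>v = z1 lam + z2 d\<close> and \<open>q = (1 - z1) z3 lam - z2 d\<close>, (S1) and (S3) add up to
  \<open>\<rho>' = v - d\<close>, and (S2) says \<open>\<eta>' = q\<close>. An indefinite integral has derivative zero almost everywhere
  on each of its level sets, so \<open>v = d\<close> where \<open>\<rho> = 1\<close>, and \<open>q = 0\<close> where \<open>\<eta>\<close> is \<open>0\<close> or \<open>\<beta>\<close>;
  together with (S4) this gives the case table. The controls enter the equations only through \<open>v\<close> and
  \<open>q\<close>, which the canonical controls leave unchanged.

  For uniqueness, the content \<open>\<rho> + \<eta>\<close> is the path \<open>r0 + \<integral> lam - D\<close> reflected at \<open>1 + \<beta>\<close>, and
  \<open>\<rho> = min (\<rho> + \<eta>) 1\<close>. Hence the difference of two solutions satisfies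
  \<open>sup \<bar>\<Delta>\<rho>\<bar> \<le> 2 sup \<bar>\<Delta>D\<bar>\<close>, while (S3) and Fubini give \<open>\<Delta>D = g * (\<Delta>\<rho> + \<Delta>D)\<close> with \<open>g\<close>
  bounded; this is a contraction in an exponentially weighted supremum norm.
\<close>

section \<open>Indefinite Lebesgue integrals\<close>

text \<open>Interval measures and Fubini on \<open>lborel\<close> ask for Borel integrands, whereas
  the system is stated with \<open>lebesgue\<close>. The a.e. equal Borel version is taken of the
  function cut off outside \<open>S\<close>, so that integrals over \<open>A\<close> only see
  \<open>A \<inter> S\<close>.\<close>

lemma set_integral_lborel_representative:
  fixes h :: "real \<Rightarrow> real"
  assumes h: "set_integrable lebesgue S h"
  obtains h' where "h' \<in> borel_measurable borel" "integrable lborel h'"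
    "AE x in lebesgue. h' x = indicator S x * h x"
    "\<And>A. A \<in> sets borel \<Longrightarrow> (LINT x:A|lborel. h' x) = (LINT x:A \<inter> S|lebesgue. h x)"
proof -
  have hi: "integrable lebesgue (\<lambda>x. indicator S x * h x)"
    using h by (simp add: set_integrable_def)
  then obtain h' where h': "h' \<in> borel_measurable lborel" "AE x in lborel. indicator S x * h x = h' x"
    using completion_ex_borel_measurable_real[of "\<lambda>x. indicator S x * h x" lborel] by blast
  have ae: "AE x in lebesgue. h' x = indicator S x * h x"
    using AE_completion[OF h'(2)] by (simp add: eq_commute)
  have hm: "h' \<in> borel_measurable lebesgue"
    using h'(1) by (simp add: measurable_completion)
  have "integrable lebesgue h'"
    using hi ae hm integrable_cong_AE[of h' lebesgue "\<lambda>x. indicator S x * h x"] by auto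
  then have int: "integrable lborel h'"
    using integrable_completion[OF h'(1)] by simp
  have "(LINT x:A|lborel. h' x) = (LINT x:A \<inter> S|lebesgue. h x)" if A: "A \<in> sets borel" for A
  proof -
    have [measurable]: "A \<in> sets lborel" "A \<in> sets lebesgue" using A by auto
    have m1: "(\<lambda>x. indicator A x *\<^sub>R h' x) \<in> borel_measurable lborel"
      using h'(1) by measurable
    have "(LINT x:A|lborel. h' x) = (LINT x|lebesgue. indicator A x *\<^sub>R h' x)"
      unfolding set_lebesgue_integral_def using integral_completion[OF m1] by simp
    also have "\<dots> = (LINT x|lebesgue. indicator (A \<inter> S) x *\<^sub>R h x)"
    proof (rule integral_cong_AE)
      show "(\<lambda>x. indicator A x *\<^sub>R h' x) \<in> borel_measurable lebesgue"
        using hm by measurable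
      have "(\<lambda>x. indicator A x *\<^sub>R (indicator S x * h x)) \<in> borel_measurable lebesgue"
        using hi by measurable
      then show "(\<lambda>x. indicator (A \<inter> S) x *\<^sub>R h x) \<in> borel_measurable lebesgue"
        by (simp add: indicator_inter_arith mult.assoc)
      show "AE x in lebesgue. indicator A x *\<^sub>R h' x = indicator (A \<inter> S) x *\<^sub>R h x"
        using ae by eventually_elim (simp add: indicator_inter_arith)
    qed
    finally show ?thesis by (simp add: set_lebesgue_integral_def)
  qed
  with h'(1) int ae that show thesis by auto
qed

lemma set_integrable_Icc_subset:
  fixes h :: "real \<Rightarrow> real"
  assumes "set_integrable lebesgue {a..b} h" "a \<le> x" "y \<le> b"
  shows "set_integrable lebesgue {x..y} h"
  by (rule set_integrable_subset[OF assms(1)]) (use assms in auto)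

lemma set_integral_Icc_combine:
  fixes h :: "real \<Rightarrow> real"
  assumes h: "set_integrable lebesgue {a..b} h" and "a \<le> x" "x \<le> y" "y \<le> b"
  shows "(LINT u:{a..y}|lebesgue. h u) = (LINT u:{a..x}|lebesgue. h u) + (LINT u:{x..y}|lebesgue. h u)"
proof -
  have "set_integrable lebesgue {a..y} h" "set_integrable lebesgue {a..x} h" "set_integrable lebesgue {x..y} h"
    using assms by (auto intro: set_integrable_Icc_subset)
  then show ?thesis
    using Henstock_Kurzweil_Integration.integral_combine[of a x y h] assms
    by (simp add: set_lebesgue_integral_eq_integral)
qed

lemma set_integral_singleton_lebesgue:
  fixes h :: "real \<Rightarrow> real"
  shows "(LINT u:{a}|lebesgue. h u) = 0"
proof -
  have "AE u in lebesgue. u \<noteq> a"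
    using AE_lborel_singleton by (intro AE_completion) 
  then have "AE u in lebesgue. indicator {a} u *\<^sub>R h u = 0"
    by eventually_elim auto
  then show ?thesis unfolding set_lebesgue_integral_def by (rule integral_eq_zero_AE)
qed

lemma continuous_on_set_integral:
  fixes h :: "real \<Rightarrow> real"
  assumes h: "set_integrable lebesgue {a..b} h"
  shows "continuous_on {a..b} (\<lambda>x. LINT u:{a..x}|lebesgue. h u)"
proof -
  have "continuous_on {a..b} (\<lambda>x. integral {a..x} h)"
    by (rule indefinite_integral_continuous_1) (use h set_lebesgue_integral_eq_integral(1) in auto)
  moreover have "integral {a..x} h = (LINT u:{a..x}|lebesgue. h u)" if "x \<in> {a..b}" for x
    using that by (intro set_lebesgue_integral_eq_integral(2)[symmetric] set_integrable_Icc_subset[OF h]) auto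
  ultimately show ?thesis
    by (rule continuous_on_eq)
qed

section \<open>Integrands recovered from their interval integrals\<close>

text \<open>The primitive \<open>J\<close> is continuous and nondecreasing, so it induces a
  Stieltjes measure \<open>M\<close>. Since \<open>M\<close> coincides with the set function given
  by integrating the Borel version \<open>h'\<close>, the latter has a nonnegative integral over
  every Borel set and is therefore nonnegative almost everywhere.\<close>

lemma AE_nonneg_if_interval_integrals_nonneg:
  fixes h :: "real \<Rightarrow> real"
  assumes h: "set_integrable lebesgue {a..b} h"
    and pos: "\<And>x y. a \<le> x \<Longrightarrow> x \<le> y \<Longrightarrow> y \<le> b \<Longrightarrow> 0 \<le> (LINT u:{x..y}|lebesgue. h u)"
  shows "AE x\<in>{a..b} in lebesgue. 0 \<le> h x"
proof (cases "a \<le> b")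
  case True
  obtain h' where h': "h' \<in> borel_measurable borel" "integrable lborel h'"
    "AE x in lebesgue. h' x = indicator {a..b} x * h x"
    "\<And>A. A \<in> sets borel \<Longrightarrow> (LINT x:A|lborel. h' x) = (LINT x:A \<inter> {a..b}|lebesgue. h x)"
    using set_integral_lborel_representative[OF h] by metis
  define J where "J x = (LINT u:{a..x}|lebesgue. h u)" for x
  \<comment> \<open>Constant continuation by \<open>0\<close> to the left of \<open>a\<close> and by
    \<open>J b\<close> to the right of \<open>b\<close> yields a distribution function of total mass
    \<open>J b\<close> on the whole line.\<close>
  define H where "H x = J (max a (min b x))" for x
  have J: "J y - J x = (LINT u:{x..y}|lebesgue. h u)" if "a \<le> x" "x \<le> y" "y \<le> b" for x y
    using set_integral_Icc_combine[OF h that] by (simp add: J_def)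
  have monoH: "H x \<le> H y" if "x \<le> y" for x y
  proof -
    let ?x = "max a (min b x)" and ?y = "max a (min b y)"
    have "a \<le> ?x" "?x \<le> ?y" "?y \<le> b" using that True by auto
    from J[OF this] pos[OF this] show ?thesis unfolding H_def by linarith
  qed
  have H_eq: "H = (\<lambda>x. J (max a (min b x)))" by (rule ext) (rule H_def)
  have "continuous_on UNIV H"
    unfolding H_eq
  proof (rule continuous_on_compose2[where g = J and t = "{a..b}"])
    show "continuous_on {a..b} J"
      unfolding J_def by (rule continuous_on_set_integral[OF h])
    show "continuous_on UNIV (\<lambda>x. max a (min b x))"
      by (intro continuous_on_max continuous_on_min continuous_on_const continuous_on_id)
  qed (use True in auto)
  then have contH: "continuous (at_right x) H" for x
    by (simp add: continuous_on_eq_continuous_at continuous_at_imp_continuous_at_within)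
  have Ja: "J a = 0" by (simp add: J_def set_integral_singleton_lebesgue)
  have top: "(H \<longlongrightarrow> J b) at_top"
    by (rule tendsto_eventually, rule eventually_mono[OF eventually_ge_at_top[of b]])
       (use True in \<open>simp add: H_def\<close>)
  have bot: "(H \<longlongrightarrow> 0) at_bot"
    by (rule tendsto_eventually, rule eventually_mono[OF eventually_le_at_bot[of a]])
       (use True in \<open>simp add: H_def Ja\<close>)
  have Jb: "0 \<le> J b" using pos[of a b] True by (simp add: J_def)
  define M where "M = interval_measure H"
  interpret M: finite_borel_measure M
    unfolding M_def
    by (rule finite_borel_measure_interval_measure[where F = H and m = "J b"])
       (use monoH contH bot top Jb in auto)
  have setsM: "sets M = sets borel" by (simp add: M_def)
  have MU: "measure M UNIV = J b"
    using interval_measure_UNIV[where F = H and m = "J b"] monoH contH bot top Jb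
    by (simp add: M_def measure_def)
  have UU: "(LINT x:UNIV|lborel. h' x) = J b"
    using h'(4)[of UNIV] by (simp add: J_def)
  \<comment> \<open>both sides agree on half-open intervals, hence on all Borel sets\<close>
  have eq: "measure M A = (LINT x:A|lborel. h' x)" if "A \<in> sets borel" for A
  proof -
    have B: "sigma_sets UNIV (range (\<lambda>(a, b). {a <.. b::real})) = sets borel"
      by (subst borel_sigma_sets_Ioc) simp
    have "Int_stable (range (\<lambda>(a, b). {a <.. b::real}))"
      by (auto simp: Int_stable_def)
    moreover have "range (\<lambda>(a, b). {a <.. b::real}) \<subseteq> Pow UNIV" by simp
    moreover have "A \<in> sigma_sets UNIV (range (\<lambda>(a, b). {a <.. b::real}))"
      using that B by simp
    ultimately show ?thesis
    proof (induction rule: sigma_sets_induct_disjoint)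
      case (basic A)
      then obtain x y where A: "A = {x<..y}" by auto
      show ?case
      proof (cases "x \<le> y")
        case True
        let ?x = "max a (min b x)" and ?y = "max a (min b y)"
        have xy: "a \<le> ?x" "?x \<le> ?y" "?y \<le> b" using True \<open>a \<le> b\<close> by auto
        have "measure M A = H y - H x"
          unfolding A M_def using True monoH contH by (intro measure_interval_measure_Ioc) auto
        also have "\<dots> = (LINT u:{?x..?y}|lebesgue. h u)"
          unfolding H_def using J[OF xy] .
        also have "\<dots> = (LINT u:{x<..y} \<inter> {a..b}|lebesgue. h u)"
        proof (rule set_integral_cong_set)
          have "set_borel_measurable lebesgue {a..b} h"
            using h by (auto simp: set_integrable_def set_borel_measurable_def)
          then show "set_borel_measurable lebesgue ({x<..y} \<inter> {a..b}) h"
            "set_borel_measurable lebesgue {?x..?y} h"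
            using xy by (auto intro!: set_borel_measurable_subset[of lebesgue "{a..b}"])
          \<comment> \<open>Clamping may leave the single point \<open>a\<close> or \<open>b\<close>
            where the intersection is empty, and \<open>{x<..y}\<close> omits \<open>x\<close>;
            these three points form a null set.\<close>
          have "AE u in lebesgue. u \<noteq> x \<and> u \<noteq> a \<and> u \<noteq> b"
            by (intro AE_conjI AE_completion AE_lborel_singleton)
          then show "AE u in lebesgue. u \<in> {x<..y} \<inter> {a..b} \<longleftrightarrow> u \<in> {?x..?y}"
            by eventually_elim (use True \<open>a \<le> b\<close> in auto)
        qed
        also have "\<dots> = (LINT u:A|lborel. h' u)"
          unfolding A using h'(4)[of "{x<..y}"] by simp
        finally show ?thesis .
      qed (simp add: A set_lebesgue_integral_def)
    next
      case empty
      then show ?case by (simp add: set_lebesgue_integral_def)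
    next
      case (compl A)
      then have A: "A \<in> sets borel" using B by simp
      have "measure M (UNIV - A) = measure M UNIV - measure M A"
        using M.finite_measure_compl[of A] A setsM by (simp add: M_def)
      moreover have "(LINT x:UNIV|lborel. h' x) = (LINT x:A|lborel. h' x) + (LINT x:UNIV - A|lborel. h' x)"
        using set_integral_Un[of A "UNIV - A" lborel h'] A
          integrable_mult_indicator[OF _ h'(2), of A] integrable_mult_indicator[OF _ h'(2), of "UNIV - A"]
        by (simp add: set_integrable_def)
      ultimately show ?case using compl MU UU by simp
    next
      case (union A)
      then have A: "range A \<subseteq> sets borel" using B by simp
      have "measure M (\<Union>i. A i) = (\<Sum>i. measure M (A i))"
        using M.finite_measure_UNION[of A] A setsM union(1) by (intro sums_unique) simp
      also have "\<dots> = (\<Sum>i. (LINT x:A i|lborel. h' x))"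
        using union(3) by simp
      also have "\<dots> = (LINT x:(\<Union>i. A i)|lborel. h' x)"
      proof (rule lebesgue_integral_countable_add[symmetric])
        show "set_integrable lborel (\<Union>i. A i) h'"
          using A h'(2) unfolding set_integrable_def by (intro integrable_mult_indicator) auto
      qed (use A union(1) in \<open>auto simp: disjoint_family_on_def\<close>)
      finally show ?case .
    qed
  qed
  have "AE x in lborel. 0 \<le> h' x"
  proof (rule sigma_finite_measure.density_nonneg[OF sigma_finite_lborel h'(2)])
    fix A assume "A \<in> sets (lborel :: real measure)"
    then show "0 \<le> (LINT x:A|lborel. h' x)" using eq[of A] measure_nonneg[of M A] by simp
  qed
  then have "AE x in lebesgue. 0 \<le> h' x" by (rule AE_completion)
  with h'(3) show ?thesis by eventually_elim auto
next
  case False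
  then have "{a..b} = {}" by simp
  then show ?thesis by (simp only: empty_iff simp_thms) simp
qed

lemma AE_zero_if_interval_integrals_zero:
  fixes h :: "real \<Rightarrow> real"
  assumes h: "set_integrable lebesgue {a..b} h"
    and zero: "\<And>t. a \<le> t \<Longrightarrow> t \<le> b \<Longrightarrow> (LINT u:{a..t}|lebesgue. h u) = 0"
  shows "AE x\<in>{a..b} in lebesgue. h x = 0"
proof -
  have xy: "(LINT u:{x..y}|lebesgue. h u) = 0" if "a \<le> x" "x \<le> y" "y \<le> b" for x y
    using set_integral_Icc_combine[OF h that] zero[of x] zero[of y] that by simp
  have "AE x\<in>{a..b} in lebesgue. 0 \<le> h x"
    by (rule AE_nonneg_if_interval_integrals_nonneg[OF h]) (simp add: xy)
  moreover have "AE x\<in>{a..b} in lebesgue. 0 \<le> - h x"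
  proof (rule AE_nonneg_if_interval_integrals_nonneg)
    show "set_integrable lebesgue {a..b} (\<lambda>x. - h x)"
      using h by (simp add: set_integrable_def)
    show "0 \<le> (LINT u:{x..y}|lebesgue. - h u)" if "a \<le> x" "x \<le> y" "y \<le> b" for x y
      using xy[OF that] by (simp add: set_lebesgue_integral_def)
  qed
  ultimately show ?thesis by eventually_elim auto
qed

lemma set_integrable_indicator_mult:
  fixes h :: "real \<Rightarrow> real"
  assumes "set_integrable lebesgue A h" "B \<in> sets lebesgue"
  shows "set_integrable lebesgue A (\<lambda>u. indicator B u * h u)"
proof -
  have "(\<lambda>x. indicator A x *\<^sub>R (indicator B x * h x)) = (\<lambda>x. indicator B x *\<^sub>R (indicator A x *\<^sub>R h x))"
    by (auto simp: fun_eq_iff)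
  then show ?thesis
    using integrable_mult_indicator[OF assms(2) assms(1)[unfolded set_integrable_def]]
    by (simp add: set_integrable_def)
qed

text \<open>It suffices that \<open>k\<close>, the part of \<open>h\<close> on the level set
  \<open>E\<close>, has zero integral over every \<open>{a..t}\<close>. These integrals are
  dominated by the mass of \<open>\<bar>h\<bar>\<close> on \<open>N n\<close>, the points off
  \<open>E\<close> at distance less than \<open>1 / Suc n\<close> from it. As \<open>E\<close> is
  closed, the sets \<open>N n\<close> decrease to the empty set and the bound tends to zero.\<close>

lemma AE_zero_on_level_set:
  fixes h H :: "real \<Rightarrow> real"
  assumes h: "set_integrable lebesgue {a..b} h"
    and H: "\<And>t. a \<le> t \<Longrightarrow> t \<le> b \<Longrightarrow> H t = H0 + (LINT u:{a..t}|lebesgue. h u)"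
  shows "AE t\<in>{a..b} in lebesgue. H t = c \<longrightarrow> h t = 0"
proof -
  define E where "E = {t\<in>{a..b}. H t = c}"
  have contH: "continuous_on {a..b} H"
    by (rule continuous_on_eq[of _ "\<lambda>t. H0 + (LINT u:{a..t}|lebesgue. h u)"])
       (auto intro!: continuous_on_add continuous_on_const continuous_on_set_integral[OF h] simp: H)
  have clE: "closed E"
    unfolding E_def by (rule continuous_closed_preimage_constant[OF contH closed_atLeastAtMost])
  then have [measurable]: "E \<in> sets lebesgue" by auto
  define N where "N n = {t\<in>{a..b}. infdist t E < 1 / Suc n} - E" for n :: nat
  have Nm [measurable]: "N n \<in> sets lebesgue" for n
  proof -
    have "{t\<in>{a..b}. infdist t E < 1 / Suc n} = {a..b} \<inter> {t. infdist t E < 1 / Suc n}" by auto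
    moreover have "open {t. infdist t E < 1 / Suc n}"
      by (intro open_Collect_less continuous_intros)
    ultimately show ?thesis unfolding N_def using clE by auto
  qed
  define k where "k u = indicator E u * h u" for u
  have k: "set_integrable lebesgue {a..b} k"
    unfolding k_def by (rule set_integrable_indicator_mult[OF h]) simp
  define p where "p n u = indicator (N n) u * \<bar>h u\<bar>" for n :: nat and u
  have p: "set_integrable lebesgue {a..b} (p n)" for n
    unfolding p_def by (rule set_integrable_indicator_mult[OF set_integrable_abs[OF h]]) simp
  \<comment> \<open>On a short interval meeting \<open>E\<close>, the integral of \<open>h\<close> from the first to the last point of \<open>E\<close>
    is zero, so the part over \<open>E\<close> is cancelled by the part over nearby points off \<open>E\<close>; bisection
    glues these local estimates together.\<close>
  have bound: "\<bar>LINT u:{x..y}|lebesgue. k u\<bar> \<le> (LINT u:{x..y}|lebesgue. p n u)"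
    if "E \<noteq> {}" "a \<le> x" "x \<le> y" "y \<le> b" for x y n
  proof -
    let ?P = "\<lambda>x y. a \<le> x \<longrightarrow> x \<le> y \<longrightarrow> y \<le> b \<longrightarrow>
      \<bar>LINT u:{x..y}|lebesgue. k u\<bar> \<le> (LINT u:{x..y}|lebesgue. p n u)"
    have "?P x y"
      using \<open>x \<le> y\<close>
    proof (induction rule: Bolzano)
      case (trans x y z)
      show ?case
      proof (intro impI)
        assume *: "a \<le> x" "x \<le> z" "z \<le> b"
        have "set_integrable lebesgue {x..z} k" "set_integrable lebesgue {x..z} (p n)"
          using * by (auto intro: set_integrable_Icc_subset[OF k] set_integrable_Icc_subset[OF p])
        then have "(LINT u:{x..z}|lebesgue. k u) = (LINT u:{x..y}|lebesgue. k u) + (LINT u:{y..z}|lebesgue. k u)"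
          "(LINT u:{x..z}|lebesgue. p n u) = (LINT u:{x..y}|lebesgue. p n u) + (LINT u:{y..z}|lebesgue. p n u)"
          using trans * by (auto intro!: set_integral_Icc_combine)
        then show "\<bar>LINT u:{x..z}|lebesgue. k u\<bar> \<le> (LINT u:{x..z}|lebesgue. p n u)"
          using trans * by auto
      qed
    next
      case (local w)
      have "?P x y" if "y - x < 1 / Suc n" for x y
      proof (intro impI)
        assume xy: "a \<le> x" "x \<le> y" "y \<le> b"
        note sub = set_integrable_Icc_subset[of a b _ x y, OF _ xy(1,3)]
        show "\<bar>LINT u:{x..y}|lebesgue. k u\<bar> \<le> (LINT u:{x..y}|lebesgue. p n u)"
        proof (cases "E \<inter> {x..y} = {}")
          case True
          have "(LINT u:{x..y}|lebesgue. k u) = (LINT u:{x..y}|lebesgue. 0)"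
            by (rule set_lebesgue_integral_cong) (use True in \<open>auto simp: k_def indicator_def\<close>)
          moreover have "0 \<le> (LINT u:{x..y}|lebesgue. p n u)"
            unfolding set_lebesgue_integral_def by (intro integral_nonneg_AE) (auto simp: p_def)
          ultimately show ?thesis by simp
        next
          case False
          have "compact (E \<inter> {x..y})"
            using clE by (simp add: closed_Int_compact)
          then obtain l r where l: "l \<in> E \<inter> {x..y}" "\<And>u. u \<in> E \<inter> {x..y} \<Longrightarrow> l \<le> u"
            and r: "r \<in> E \<inter> {x..y}" "\<And>u. u \<in> E \<inter> {x..y} \<Longrightarrow> u \<le> r"
            using compact_attains_inf[of "E \<inter> {x..y}"] compact_attains_sup[of "E \<inter> {x..y}"] False
            by metis
          have lr: "l \<le> r" "a \<le> l" "r \<le> b" "x \<le> l" "r \<le> y" using l r xy by auto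
          have "H l = c" "H r = c" using l r by (auto simp: E_def)
          then have hz: "(LINT u:{l..r}|lebesgue. h u) = 0"
            using set_integral_Icc_combine[OF h lr(2,1,3)] H[of l] H[of r] lr by simp
          have hlr: "set_integrable lebesgue {l..r} h" "set_integrable lebesgue {l..r} k"
            using lr by (auto intro: set_integrable_Icc_subset[OF h] set_integrable_Icc_subset[OF k])
          have "(LINT u:{x..y}|lebesgue. k u) = (LINT u:{l..r}|lebesgue. k u)"
            unfolding set_lebesgue_integral_def
            by (rule Bochner_Integration.integral_cong[OF refl])
               (use l r in \<open>auto simp: k_def indicator_def\<close>)
          also have "\<dots> = (LINT u:{l..r}|lebesgue. k u - h u)"
            using set_integral_diff(2)[OF hlr(2,1)] hz by simp
          also have "\<bar>\<dots>\<bar> \<le> (LINT u|lebesgue. \<bar>indicator {l..r} u *\<^sub>R (k u - h u)\<bar>)"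
            unfolding set_lebesgue_integral_def by (rule integral_abs_bound)
          also have "\<dots> \<le> (LINT u:{x..y}|lebesgue. p n u)"
            unfolding set_lebesgue_integral_def
          proof (rule integral_mono)
            show "integrable lebesgue (\<lambda>u. \<bar>indicator {l..r} u *\<^sub>R (k u - h u)\<bar>)"
              using set_integral_diff(1)[OF hlr(2,1)] by (intro integrable_abs) (simp add: set_integrable_def)
            show "integrable lebesgue (\<lambda>u. indicator {x..y} u *\<^sub>R p n u)"
              using sub[OF p] by (simp add: set_integrable_def)
            fix u
            show "\<bar>indicator {l..r} u *\<^sub>R (k u - h u)\<bar> \<le> indicator {x..y} u *\<^sub>R p n u"
            proof (cases "u \<in> {l..r} \<and> u \<notin> E")
              case True
              \<comment> \<open>On \<open>E\<close> the integrand \<open>k - h\<close> vanishes and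
                off \<open>E\<close> it equals \<open>- h\<close>. All of \<open>{l..r}\<close> is
                closer than \<open>1 / Suc n\<close> to \<open>l \<in> E\<close>, so its points off
                \<open>E\<close> lie in \<open>N n\<close>.\<close>
              have "infdist u E \<le> dist u l" using l by (intro infdist_le) auto
              also have "\<dots> < 1 / Suc n" using True lr that by (auto simp: dist_real_def)
              finally show ?thesis using True lr by (auto simp: p_def k_def N_def)
            qed (auto simp: k_def p_def)
          qed
          finally show ?thesis .
        qed
      qed
      then show ?case by (intro exI[of _ "1 / Suc n"]) auto
    qed
    then show ?thesis using that by blast
  qed
  have lim: "(\<lambda>n. LINT u:{x..y}|lebesgue. p n u) \<longlonglongrightarrow> 0" if "E \<noteq> {}" "a \<le> x" "x \<le> y" "y \<le> b" for x y
  proof -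
    have dec: "decseq (\<lambda>n. N n \<inter> {x..y})"
    proof (rule decseq_SucI, rule subsetI)
      fix n u assume "u \<in> N (Suc n) \<inter> {x..y}"
      moreover have "1 / real (Suc (Suc n)) \<le> 1 / real (Suc n)" by (simp add: frac_le)
      ultimately show "u \<in> N n \<inter> {x..y}" by (auto simp: N_def)
    qed
    have empty: "(\<Inter>n. N n \<inter> {x..y}) = {}"
    proof (rule equals0I)
      fix u assume u: "u \<in> (\<Inter>n. N n \<inter> {x..y})"
      then have "u \<notin> E" by (auto simp: N_def)
      then have "0 < infdist u E" using infdist_pos_not_in_closed[OF clE \<open>E \<noteq> {}\<close>] by simp
      then obtain n where "inverse (real (Suc n)) < infdist u E" using reals_Archimedean by blast
      moreover have "u \<in> N n" using u by auto
      ultimately show False by (auto simp: N_def inverse_eq_divide)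
    qed
    have "(\<lambda>n. LINT u:N n \<inter> {x..y}|lebesgue. \<bar>h u\<bar>) \<longlonglongrightarrow> (LINT u:(\<Inter>n. N n \<inter> {x..y})|lebesgue. \<bar>h u\<bar>)"
    proof (rule set_integral_cont_down[OF _ dec])
      show "set_integrable lebesgue (N 0 \<inter> {x..y}) (\<lambda>u. \<bar>h u\<bar>)"
      proof (rule set_integrable_subset[OF set_integrable_abs[OF h]])
        show "N 0 \<inter> {x..y} \<in> sets lebesgue" by (intro sets.Int Nm) simp
      qed (auto simp: N_def)
    qed (intro sets.Int Nm, simp)
    moreover have "(LINT u:N n \<inter> {x..y}|lebesgue. \<bar>h u\<bar>) = (LINT u:{x..y}|lebesgue. p n u)" for n
      unfolding set_lebesgue_integral_def
      by (rule Bochner_Integration.integral_cong) (auto simp: p_def indicator_def)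
    ultimately show ?thesis unfolding empty by (simp add: set_lebesgue_integral_def)
  qed
  have "AE t\<in>{a..b} in lebesgue. k t = 0"
  proof (rule AE_zero_if_interval_integrals_zero[OF k])
    fix t assume t: "a \<le> t" "t \<le> b"
    show "(LINT u:{a..t}|lebesgue. k u) = 0"
    proof (cases "E = {}")
      \<comment> \<open>\<open>infdist\<close> to the empty set is \<open>0\<close> by convention,
        so the \<open>N n\<close> would not shrink here; instead \<open>k\<close> is identically
        zero.\<close>
      case True
      then show ?thesis by (simp add: k_def)
    next
      case False
      have "\<bar>LINT u:{a..t}|lebesgue. k u\<bar> \<le> 0"
        by (rule LIMSEQ_le_const[OF lim[OF False order_refl t]])
           (use bound[OF False order_refl t] in blast)
      then show ?thesis by simp
    qed
  qed
  then show ?thesis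
    by eventually_elim (auto simp: k_def E_def)
qed

text \<open>The zero set is closed and contains almost every point of the open interval, hence all
  of it and also its closure. This turns the complementarity in (S5) into an identity at every
  time.\<close>

lemma continuous_on_AE_zero_imp_zero:
  fixes p :: "real \<Rightarrow> real"
  assumes "a < b" "continuous_on {a..b} p" "AE x\<in>{a..b} in lebesgue. p x = 0" "x \<in> {a..b}"
  shows "p x = 0"
proof -
  let ?C = "{x\<in>{a..b}. p x = 0}"
  have C: "closed ?C"
    by (rule continuous_closed_preimage_constant[OF assms(2)]) simp
  have "AE x\<in>{a<..<b} in lebesgue. x \<in> ?C"
    using assms(3) by eventually_elim auto
  then have "{a<..<b} \<subseteq> ?C"
    using mem_closed_if_AE_lebesgue_open[OF open_greaterThanLessThan C] by blast
  then have "closure {a<..<b} \<subseteq> ?C"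
    using C by (rule closure_minimal)
  then show ?thesis using assms(1,4) by auto
qed

lemma set_integrable_mult_bounded:
  fixes h z :: "real \<Rightarrow> real"
  assumes h: "set_integrable lebesgue A h" and z: "set_borel_measurable lebesgue A z"
    and b: "AE x\<in>A in lebesgue. \<bar>z x\<bar> \<le> 1"
  shows "set_integrable lebesgue A (\<lambda>x. z x * h x)"
  unfolding set_integrable_def
proof (rule Bochner_Integration.integrable_bound)
  show "integrable lebesgue (\<lambda>x. indicator A x *\<^sub>R h x)"
    using h by (simp add: set_integrable_def)
  have eq: "(\<lambda>x. indicator A x *\<^sub>R (z x * h x)) = (\<lambda>x. (indicator A x *\<^sub>R z x) * (indicator A x *\<^sub>R h x))"
    by (auto simp: fun_eq_iff indicator_def)
  show "(\<lambda>x. indicator A x *\<^sub>R (z x * h x)) \<in> borel_measurable lebesgue"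
    unfolding eq using h z
    by (intro borel_measurable_times) (auto simp: set_integrable_def set_borel_measurable_def)
  show "AE x in lebesgue. norm (indicator A x *\<^sub>R (z x * h x)) \<le> norm (indicator A x *\<^sub>R h x)"
    using b
  proof eventually_elim
    case (elim x)
    then show ?case
      using mult_right_mono[of "\<bar>z x\<bar>" 1 "\<bar>h x\<bar>"] by (auto simp: indicator_def abs_mult)
  qed
qed

lemma set_integral_eq_AE:
  fixes h k :: "real \<Rightarrow> real"
  assumes "set_integrable lebesgue A h" "set_integrable lebesgue A k"
    and "AE x\<in>A in lebesgue. h x = k x"
  shows "(LINT x:A|lebesgue. h x) = (LINT x:A|lebesgue. k x)"
  unfolding set_lebesgue_integral_def
proof (rule integral_cong_AE)
  show "AE x in lebesgue. indicator A x *\<^sub>R h x = indicator A x *\<^sub>R k x"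
    using assms(3) by eventually_elim (auto simp: indicator_def)
qed (use assms in \<open>auto simp: set_integrable_def\<close>)

section \<open>Convolution with a bounded density\<close>

lemma cdf_with_density_LINT:
  assumes "cdf_with_density G g"
  shows "integrable lborel g" "G x = (LINT s|lborel. indicator {..x} s * g s)"
proof -
  have [measurable]: "g \<in> borel_measurable borel" and g0: "\<And>x. 0 \<le> g x"
    and ps: "prob_space (density lborel (\<lambda>x. ennreal (g x)))"
    and G: "G = cdf (density lborel (\<lambda>x. ennreal (g x)))"
    using assms by (auto simp: cdf_with_density_def)
  interpret prob_space "density lborel (\<lambda>x. ennreal (g x))" by (rule ps)
  have "(\<integral>\<^sup>+ x. ennreal (g x) \<partial>lborel) = 1"
    using emeasure_space_1 by (simp add: emeasure_density)
  then show "integrable lborel g"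
    by (intro integrableI_nonneg) (auto simp: g0)
  have "G x = (LINT s|density lborel (\<lambda>x. ennreal (g x)). indicator {..x} s)"
    by (simp add: G cdf_def)
  also have "\<dots> = (LINT s|lborel. g s * indicator {..x} s)"
    by (subst integral_density) (auto simp: g0)
  finally show "G x = (LINT s|lborel. indicator {..x} s * g s)" by (simp add: mult.commute)
qed

lemma cdf_with_density_props:
  assumes "cdf_with_density G g"
  shows "mono G" "0 \<le> G x" "G x \<le> 1" "x \<le> 0 \<Longrightarrow> G x = 0" "continuous_on UNIV G"
proof -
  have [measurable]: "g \<in> borel_measurable borel" and g0: "\<And>x. 0 \<le> g x" "\<And>x. x < 0 \<Longrightarrow> g x = 0"
    and ps: "prob_space (density lborel (\<lambda>x. ennreal (g x)))"
    and G: "G = cdf (density lborel (\<lambda>x. ennreal (g x)))"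
    using assms by (auto simp: cdf_with_density_def)
  interpret real_distribution "density lborel (\<lambda>x. ennreal (g x))"
    using ps by (auto simp: real_distribution_def real_distribution_axioms_def)
  show "mono G" "0 \<le> G x" "G x \<le> 1"
    by (auto simp: G mono_def cdf_nondecreasing cdf_nonneg cdf_bounded_prob)
  show "G x = 0" if "x \<le> 0"
  proof -
    have "AE s in lborel. s \<noteq> 0" by (rule AE_lborel_singleton)
    then have "AE s in lborel. indicator {..x} s * g s = 0"
      by eventually_elim (use that g0 in \<open>auto simp: indicator_def\<close>)
    then show ?thesis using cdf_with_density_LINT[OF assms] integral_eq_zero_AE by metis
  qed
  have "measure (density lborel (\<lambda>x. ennreal (g x))) {x} = 0" for x
  proof -
    have "AE s in lborel. s \<noteq> x" by (rule AE_lborel_singleton)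
    then have "AE s in lborel. ennreal (g s) * indicator {x} s = 0"
      by eventually_elim auto
    then have "(\<integral>\<^sup>+s. ennreal (g s) * indicator {x} s \<partial>lborel) = 0"
      by (subst nn_integral_0_iff_AE) auto
    then show ?thesis by (simp add: measure_def emeasure_density)
  qed
  then show "continuous_on UNIV G"
    by (simp add: G continuous_on_eq_continuous_at isCont_cdf)
qed

lemma cdf_with_density_lipschitz:
  assumes G: "cdf_with_density G g" and c: "\<And>x. g x \<le> c" and "x \<le> y"
  shows "G y - G x \<le> c * (y - x)"
proof -
  have [measurable]: "g \<in> borel_measurable borel"
    using G by (auto simp: cdf_with_density_def)
  have i: "integrable lborel (\<lambda>s. indicator {..x} s * g s)" for x
    using integrable_mult_indicator[OF _ cdf_with_density_LINT(1)[OF G], of "{..x}"] by simp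
  have "G y - G x = (LINT s|lborel. indicator {..y} s * g s - indicator {..x} s * g s)"
    using i by (simp add: cdf_with_density_LINT(2)[OF G])
  also have "\<dots> \<le> (LINT s|lborel. indicator {x<..y} s * c)"
  proof (rule integral_mono)
    show "integrable lborel (\<lambda>s. indicator {x<..y} s * c)"
      using \<open>x \<le> y\<close> by (intro integrable_mult_left integrable_real_indicator) auto
    show "indicator {..y} s * g s - indicator {..x} s * g s \<le> indicator {x<..y} s * c" for s
      using c[of s] \<open>x \<le> y\<close> by (auto simp: indicator_def)
  qed (use i in auto)
  also have "\<dots> = c * (y - x)" using \<open>x \<le> y\<close> by simp
  finally show ?thesis .
qed

text \<open>Fubini after writing \<open>G (t - u)\<close> as the integral of \<open>g\<close> over
  \<open>{..t - u}\<close>. The density now acts on the primitive of \<open>v\<close>, so a supremum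
  bound on that primitive is enough to estimate the convolution; no pointwise bound on
  \<open>v\<close> is required.\<close>

lemma set_integral_convolution_cdf:
  fixes v :: "real \<Rightarrow> real"
  assumes G: "cdf_with_density G g" and v: "set_integrable lebesgue {0..t} v"
  shows "(LINT u:{0..t}|lebesgue. v u * G (t - u))
    = (LINT s:{0..t}|lborel. g s * (LINT u:{0..t - s}|lebesgue. v u))"
proof -
  have [measurable]: "g \<in> borel_measurable borel" and g0: "\<And>x. 0 \<le> g x" "\<And>x. x < 0 \<Longrightarrow> g x = 0"
    using G by (auto simp: cdf_with_density_def)
  have [measurable]: "G \<in> borel_measurable borel"
    using cdf_with_density_props(5)[OF G] by (rule borel_measurable_continuous_onI)
  obtain w where w[measurable]: "w \<in> borel_measurable borel" and wi: "integrable lborel w"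
    and wae: "AE x in lebesgue. w x = indicator {0..t} x * v x"
    and wset: "\<And>A. A \<in> sets borel \<Longrightarrow> (LINT x:A|lborel. w x) = (LINT x:A \<inter> {0..t}|lebesgue. v x)"
    using set_integral_lborel_representative[OF v] by metis
  have gi: "integrable lborel g" by (rule cdf_with_density_LINT(1)[OF G])
  define \<phi> where "\<phi> = (\<lambda>u s. w u * (indicator {..t - u} s * g s))"
  have [measurable]: "(\<lambda>(u, s). indicator {..t - u} s :: real) \<in> borel_measurable (lborel \<Otimes>\<^sub>M lborel)"
  proof -
    have "(\<lambda>(u, s). indicator {..t - u} s :: real) = (\<lambda>p. if snd p \<le> t - fst p then 1 else 0)"
      by (auto simp: fun_eq_iff)
    then show ?thesis by simp
  qed
  have int: "integrable (lborel \<Otimes>\<^sub>M lborel) (case_prod \<phi>)"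
  proof (rule Bochner_Integration.integrable_bound)
    show "integrable (lborel \<Otimes>\<^sub>M lborel) (\<lambda>(u, s). w u * g s)"
    proof (rule lborel_pair.Fubini_integrable)
      show "integrable lborel (\<lambda>x. LINT y|lborel. norm (case (x, y) of (u, s) \<Rightarrow> w u * g s))"
        using wi by (simp add: abs_mult g0)
      show "AE x in lborel. integrable lborel (\<lambda>y. case (x, y) of (u, s) \<Rightarrow> w u * g s)"
        using gi by simp
    qed simp
    show "case_prod \<phi> \<in> borel_measurable (lborel \<Otimes>\<^sub>M lborel)"
      unfolding \<phi>_def by measurable
    show "AE x in lborel \<Otimes>\<^sub>M lborel. norm (case_prod \<phi> x) \<le> norm (case x of (u, s) \<Rightarrow> w u * g s)"
      by (rule AE_I2) (auto simp: \<phi>_def abs_mult indicator_def)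
  qed
  have "(LINT u:{0..t}|lebesgue. v u * G (t - u)) = (LINT u|lebesgue. w u * G (t - u))"
    unfolding set_lebesgue_integral_def
  proof (rule integral_cong_AE)
    have [measurable]: "(\<lambda>u. indicator {0..t} u * v u) \<in> borel_measurable lebesgue"
      using v by (simp add: set_integrable_def)
    have [measurable]: "(\<lambda>u. G (t - u)) \<in> borel_measurable lebesgue"
      by (rule measurable_completion) simp
    have "(\<lambda>u. (indicator {0..t} u * v u) * G (t - u)) \<in> borel_measurable lebesgue" by measurable
    then show "(\<lambda>u. indicator {0..t} u *\<^sub>R (v u * G (t - u))) \<in> borel_measurable lebesgue"
      by (simp add: mult.assoc)
    show "(\<lambda>u. w u * G (t - u)) \<in> borel_measurable lebesgue"
      by (rule measurable_completion) simp
    show "AE u in lebesgue. indicator {0..t} u *\<^sub>R (v u * G (t - u)) = w u * G (t - u)"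
      using wae by eventually_elim simp
  qed
  also have "\<dots> = (LINT u|lborel. w u * G (t - u))"
    by (rule integral_completion) simp
  also have "\<dots> = (LINT u|lborel. LINT s|lborel. \<phi> u s)"
    by (simp add: \<phi>_def cdf_with_density_LINT(2)[OF G])
  also have "\<dots> = (LINT s|lborel. LINT u|lborel. \<phi> u s)"
    by (rule lborel_pair.Fubini_integral[OF int, symmetric])
  also have "\<dots> = (LINT s:{0..t}|lborel. g s * (LINT u:{0..t - s}|lebesgue. v u))"
    unfolding set_lebesgue_integral_def[of lborel "{0..t}"]
  proof (rule Bochner_Integration.integral_cong[OF refl])
    fix s
    have "(LINT u|lborel. \<phi> u s) = (LINT u|lborel. g s * (indicator {..t - s} u *\<^sub>R w u))"
      by (rule Bochner_Integration.integral_cong) (auto simp: \<phi>_def indicator_def)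
    also have "\<dots> = g s * (LINT u:{..t - s}|lborel. w u)"
      by (simp add: set_lebesgue_integral_def)
    also have "\<dots> = g s * (LINT u:{..t - s} \<inter> {0..t}|lebesgue. v u)"
      by (simp add: wset)
    also have "\<dots> = indicator {0..t} s *\<^sub>R (g s * (LINT u:{0..t - s}|lebesgue. v u))"
    proof -
      \<comment> \<open>Negative \<open>s\<close> drop out because \<open>g s = 0\<close>, and for
        \<open>s > t\<close> the integration set is empty.\<close>
      consider "s < 0" | "t < s" | "0 \<le> s" "s \<le> t" by linarith
      then show ?thesis
      proof cases
        case 3
        then have "{..t - s} \<inter> {0..t} = {0..t - s}" by auto
        then show ?thesis using 3 by simp
      qed (auto simp: g0 set_lebesgue_integral_def)
    qed
    finally show "(LINT u|lborel. \<phi> u s) = indicator {0..t} s *\<^sub>R (g s * (LINT u:{0..t - s}|lebesgue. v u))" .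
  qed
  finally show ?thesis .
qed

lemma set_integrable_mult_cdf:
  fixes v :: "real \<Rightarrow> real"
  assumes G: "cdf_with_density G g" and v: "set_integrable lebesgue {0..t} v"
  shows "set_integrable lebesgue {0..t} (\<lambda>u. v u * G (t - u))"
    "set_integrable lebesgue {0..t} (\<lambda>u. v u * (1 - G (t - u)))"
proof -
  have [measurable]: "G \<in> borel_measurable borel"
    using cdf_with_density_props(5)[OF G] by (rule borel_measurable_continuous_onI)
  have "(\<lambda>u. indicator {0..t} u *\<^sub>R G (t - u)) \<in> borel_measurable lebesgue"
    by (rule measurable_completion) simp
  then have "set_integrable lebesgue {0..t} (\<lambda>u. G (t - u) * v u)"
    using cdf_with_density_props[OF G]
    by (intro set_integrable_mult_bounded[OF v]) (auto simp: set_borel_measurable_def)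
  then show 1: "set_integrable lebesgue {0..t} (\<lambda>u. v u * G (t - u))"
    by (simp add: mult.commute)
  have "set_integrable lebesgue {0..t} (\<lambda>u. v u - v u * G (t - u))"
    by (rule set_integral_diff(1)[OF v 1])
  then show "set_integrable lebesgue {0..t} (\<lambda>u. v u * (1 - G (t - u)))"
    by (simp add: algebra_simps)
qed

lemma integral_exp_reflected_le:
  fixes \<mu> t :: real
  assumes "0 < \<mu>" "0 \<le> t"
  shows "(LINT s:{0..t}|lborel. exp (\<mu> * (t - s))) \<le> exp (\<mu> * t) / \<mu>"
proof -
  have "(LINT s:{0..t}|lborel. exp (\<mu> * (t - s))) = - exp (\<mu> * (t - t)) / \<mu> - (- exp (\<mu> * (t - 0)) / \<mu>)"
    unfolding set_lebesgue_integral_def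
  proof (rule integral_FTC_atLeastAtMost[OF assms(2)])
    fix s assume "0 \<le> s" "s \<le> t"
    have "((\<lambda>s. - exp (\<mu> * (t - s)) / \<mu>) has_real_derivative exp (\<mu> * (t - s))) (at s within {0..t})"
      using assms by (auto intro!: derivative_eq_intros)
    then show "((\<lambda>s. - exp (\<mu> * (t - s)) / \<mu>) has_vector_derivative exp (\<mu> * (t - s))) (at s within {0..t})"
      by (simp add: has_real_derivative_iff_has_vector_derivative)
  qed (intro continuous_intros)
  then show ?thesis using assms by simp
qed

text \<open>In the norm weighted by \<open>exp (- \<mu> * s)\<close>, convolution with a density
  bounded by \<open>c\<close> costs a factor \<open>c / \<mu>\<close>, which is small for large
  \<open>\<mu>\<close>.\<close>

lemma convolution_density_bound:
  fixes y :: "real \<Rightarrow> real"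
  assumes g: "g \<in> borel_measurable borel" "\<And>x. 0 \<le> g x" "\<And>x. g x \<le> c"
    and y: "continuous_on {0..t} y" "\<And>s. s \<in> {0..t} \<Longrightarrow> \<bar>y s\<bar> \<le> K * exp (\<mu> * s)"
    and "0 < \<mu>" "0 \<le> t"
  shows "\<bar>LINT s:{0..t}|lborel. g s * y (t - s)\<bar> \<le> c * K * exp (\<mu> * t) / \<mu>"
proof -
  have K: "0 \<le> K" using y(2)[of 0] \<open>0 \<le> t\<close> by auto
  have c: "0 \<le> c" using g(2,3)[of 0] by simp
  have bound: "\<bar>g s * y (t - s)\<bar> \<le> c * K * exp (\<mu> * (t - s))" if "s \<in> {0..t}" for s
  proof -
    have "\<bar>g s * y (t - s)\<bar> \<le> c * (K * exp (\<mu> * (t - s)))"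
      unfolding abs_mult using g(2,3)[of s] y(2)[of "t - s"] that c by (intro mult_mono) auto
    then show ?thesis by (simp add: mult.assoc)
  qed
  have i: "set_integrable lborel {0..t} (\<lambda>s. c * K * exp (\<mu> * (t - s)))"
    by (intro borel_integrable_atLeastAtMost' continuous_intros)
  have "continuous_on {0..t} (\<lambda>s. y (t - s))"
    by (rule continuous_on_compose2[OF y(1)]) (auto intro!: continuous_intros)
  from borel_measurable_continuous_on_indicator[OF _ this]
  have [measurable]: "(\<lambda>s. indicator {0..t} s * y (t - s)) \<in> borel_measurable borel" by simp
  have [measurable]: "g \<in> borel_measurable borel" by (rule g(1))
  have eq: "(\<lambda>s. indicator {0..t} s *\<^sub>R (g s * y (t - s))) = (\<lambda>s. g s * (indicator {0..t} s * y (t - s)))"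
    by (simp add: fun_eq_iff)
  have j: "set_integrable lborel {0..t} (\<lambda>s. g s * y (t - s))"
    unfolding set_integrable_def
  proof (rule Bochner_Integration.integrable_bound[OF i[unfolded set_integrable_def]])
    show "(\<lambda>s. indicator {0..t} s *\<^sub>R (g s * y (t - s))) \<in> borel_measurable lborel"
      unfolding eq by measurable
    show "AE s in lborel. norm (indicator {0..t} s *\<^sub>R (g s * y (t - s)))
        \<le> norm (indicator {0..t} s *\<^sub>R (c * K * exp (\<mu> * (t - s))))"
    proof (rule AE_I2)
      fix s
      show "norm (indicator {0..t} s *\<^sub>R (g s * y (t - s)))
          \<le> norm (indicator {0..t} s *\<^sub>R (c * K * exp (\<mu> * (t - s))))"
        using bound[of s] by (cases "s \<in> {0..t}") auto
    qed
  qed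
  have "\<bar>LINT s:{0..t}|lborel. g s * y (t - s)\<bar> \<le> (LINT s:{0..t}|lborel. \<bar>g s * y (t - s)\<bar>)"
    unfolding set_lebesgue_integral_def
    by (rule order_trans[OF integral_abs_bound]) (simp add: abs_mult)
  also have "\<dots> \<le> (LINT s:{0..t}|lborel. c * K * exp (\<mu> * (t - s)))"
    by (rule set_integral_mono[OF set_integrable_abs[OF j] i bound])
  also have "\<dots> = c * K * (LINT s:{0..t}|lborel. exp (\<mu> * (t - s)))"
    by (rule set_integral_mult_right)
  also have "\<dots> \<le> c * K * (exp (\<mu> * t) / \<mu>)"
    using integral_exp_reflected_le[OF assms(6,7)] K c by (intro mult_left_mono) auto
  finally show ?thesis by simp
qed

section \<open>The fluid system\<close>

locale fluid_data =
  fixes lam G g F f :: "real \<Rightarrow> real" and cg \<beta> r0 T :: real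
  assumes lam: "locally_integrable_nonneg lam"
    and G: "cdf_with_density G g" and cg: "0 < cg" and g_le: "\<And>x. g x \<le> cg"
    and F: "cdf_with_density F f"
    and \<beta>: "0 \<le> \<beta>" and r0: "0 < r0" "r0 \<le> 1 + \<beta>"
    and T: "0 < T"
begin

lemma lam_integrable: "set_integrable lebesgue {0..T} lam"
  using lam T by (auto simp: locally_integrable_nonneg_def)

lemma lam_nonneg: "0 \<le> u \<Longrightarrow> 0 \<le> lam u"
  using lam by (auto simp: locally_integrable_nonneg_def)

section \<open>The system in terms of two rates instead of three controls\<close>

text \<open>The rate at which customers start service: arrivals going directly to a server, plus
  departures that pull a customer out of the queue.\<close>

definition entry_rate :: "(real \<Rightarrow> real) \<Rightarrow> (real \<Rightarrow> real) \<Rightarrow> (real \<Rightarrow> real) \<Rightarrow> real \<Rightarrow> real" where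
  "entry_rate d z1 z2 u = z1 u * lam u + z2 u * d u"

text \<open>The net growth rate of the queue: arrivals that join it minus customers moved from it to
  a server.\<close>

definition queue_rate ::
  "(real \<Rightarrow> real) \<Rightarrow> (real \<Rightarrow> real) \<Rightarrow> (real \<Rightarrow> real) \<Rightarrow> (real \<Rightarrow> real) \<Rightarrow> real \<Rightarrow> real" where
  "queue_rate d z1 z2 z3 u = (1 - z1 u) * z3 u * lam u - z2 u * d u"

lemma control_bounds_unit_interval:
  assumes "control_bounds \<beta> T \<rho> \<eta> z1 z2 z3"
  shows "AE t\<in>{0..T} in lebesgue. 0 \<le> z1 t \<and> z1 t \<le> 1 \<and> 0 \<le> z2 t \<and> z2 t \<le> 1 \<and> 0 \<le> z3 t \<and> z3 t \<le> 1"
  using assms unfolding control_bounds_def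
  by eventually_elim (auto simp: of_bool_def split: if_splits)

lemma controlled_rates_integrable:
  assumes reg: "regular_controls T d z1 z2 z3" and cb: "control_bounds \<beta> T \<rho> \<eta> z1 z2 z3"
  shows "set_integrable lebesgue {0..T} d"
    "set_integrable lebesgue {0..T} (\<lambda>u. z1 u * lam u)"
    "set_integrable lebesgue {0..T} (\<lambda>u. z2 u * d u)"
    "set_integrable lebesgue {0..T} (\<lambda>u. (1 - z1 u) * z3 u * lam u)"
    "set_integrable lebesgue {0..T} (entry_rate d z1 z2)"
    "set_integrable lebesgue {0..T} (queue_rate d z1 z2 z3)"
proof -
  note b = control_bounds_unit_interval[OF cb]
  show d: "set_integrable lebesgue {0..T} d"
    using reg by (simp add: regular_controls_def)
  have z: "set_borel_measurable lebesgue {0..T} z1" "set_borel_measurable lebesgue {0..T} z2"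
    "set_borel_measurable lebesgue {0..T} z3"
    using reg by (auto simp: regular_controls_def)
  show 1: "set_integrable lebesgue {0..T} (\<lambda>u. z1 u * lam u)"
    by (rule set_integrable_mult_bounded[OF lam_integrable z(1)]) (use b in \<open>eventually_elim, auto\<close>)
  show 2: "set_integrable lebesgue {0..T} (\<lambda>u. z2 u * d u)"
    by (rule set_integrable_mult_bounded[OF d z(2)]) (use b in \<open>eventually_elim, auto\<close>)
  have 3: "set_integrable lebesgue {0..T} (\<lambda>u. z3 u * lam u)"
    by (rule set_integrable_mult_bounded[OF lam_integrable z(3)]) (use b in \<open>eventually_elim, auto\<close>)
  have "set_integrable lebesgue {0..T} (\<lambda>u. z1 u * (z3 u * lam u))"
    by (rule set_integrable_mult_bounded[OF 3 z(1)]) (use b in \<open>eventually_elim, auto\<close>)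
  from set_integral_diff(1)[OF 3 this]
  show 4: "set_integrable lebesgue {0..T} (\<lambda>u. (1 - z1 u) * z3 u * lam u)"
    by (simp add: algebra_simps)
  show "set_integrable lebesgue {0..T} (entry_rate d z1 z2)"
    using set_integral_add(1)[OF 1 2] by (simp add: entry_rate_def[abs_def])
  show "set_integrable lebesgue {0..T} (queue_rate d z1 z2 z3)"
    using set_integral_diff(1)[OF 4 2] by (simp add: queue_rate_def[abs_def])
qed

text \<open>(S1) to (S3) with the rates as parameters: two sets of controls with a.e. equal rates
  satisfy the same equations, which is what makes the passage to canonical controls
  possible.\<close>

definition rate_equations ::
  "(real \<Rightarrow> real) \<Rightarrow> (real \<Rightarrow> real) \<Rightarrow> (real \<Rightarrow> real) \<Rightarrow> (real \<Rightarrow> real) \<Rightarrow> (real \<Rightarrow> real) \<Rightarrow> bool" where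
  "rate_equations \<rho> \<eta> d v q \<longleftrightarrow> (\<forall>t\<in>{0..T}.
     \<rho> t = min r0 1 * (1 - F t) + (LINT u:{0..t}|lebesgue. v u * (1 - G (t - u))) \<and>
     \<eta> t = max (r0 - 1) 0 + (LINT u:{0..t}|lebesgue. q u) \<and>
     (LINT u:{0..t}|lebesgue. d u) = min r0 1 * F t + (LINT u:{0..t}|lebesgue. v u * G (t - u)))"

lemma integral_equations_iff_rate_equations:
  assumes reg: "regular_controls T d z1 z2 z3" and cb: "control_bounds \<beta> T \<rho> \<eta> z1 z2 z3"
  shows "integral_equations lam G F r0 T \<rho> \<eta> d z1 z2 z3 \<longleftrightarrow>
    rate_equations \<rho> \<eta> d (entry_rate d z1 z2) (queue_rate d z1 z2 z3)"
proof -
  note int = controlled_rates_integrable[OF reg cb]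
  have "(LINT u:{0..t}|lebesgue. entry_rate d z1 z2 u * (1 - G (t - u)))
      = (LINT u:{0..t}|lebesgue. z1 u * (1 - G (t - u)) * lam u)
        + (LINT u:{0..t}|lebesgue. z2 u * (1 - G (t - u)) * d u)" (is "?A t")
    "(LINT u:{0..t}|lebesgue. entry_rate d z1 z2 u * G (t - u))
      = (LINT u:{0..t}|lebesgue. z1 u * G (t - u) * lam u)
        + (LINT u:{0..t}|lebesgue. z2 u * G (t - u) * d u)" (is "?B t")
    "(LINT u:{0..t}|lebesgue. queue_rate d z1 z2 z3 u)
      = (LINT u:{0..t}|lebesgue. (1 - z1 u) * z3 u * lam u)
        - (LINT u:{0..t}|lebesgue. z2 u * d u)" (is "?C t")
    if "t \<in> {0..T}" for t
  proof -
    have sub: "set_integrable lebesgue {0..T} h \<Longrightarrow> set_integrable lebesgue {0..t} h" for h :: "real \<Rightarrow> real"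
      using that by (auto intro: set_integrable_Icc_subset)
    note i1 = set_integrable_mult_cdf[OF G sub[OF int(2)]] and i2 = set_integrable_mult_cdf[OF G sub[OF int(3)]]
    show "?A t"
      using set_integral_add(2)[OF i1(2) i2(2)] by (simp add: entry_rate_def algebra_simps)
    show "?B t"
      using set_integral_add(2)[OF i1(1) i2(1)] by (simp add: entry_rate_def algebra_simps)
    show "?C t"
      using set_integral_diff(2)[OF sub[OF int(4)] sub[OF int(3)]] by (simp add: queue_rate_def)
  qed
  then show ?thesis
    unfolding integral_equations_def rate_equations_def by (auto simp: add.assoc add_diff_eq)
qed

lemma rate_equations_cong:
  assumes "rate_equations \<rho> \<eta> d v q"
    and v: "set_integrable lebesgue {0..T} v" "set_integrable lebesgue {0..T} v'"
    and q: "set_integrable lebesgue {0..T} q" "set_integrable lebesgue {0..T} q'"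
    and ae: "AE t\<in>{0..T} in lebesgue. v t = v' t \<and> q t = q' t"
  shows "rate_equations \<rho> \<eta> d v' q'"
proof -
  have "(LINT u:{0..t}|lebesgue. v u * (1 - G (t - u))) = (LINT u:{0..t}|lebesgue. v' u * (1 - G (t - u)))"
    "(LINT u:{0..t}|lebesgue. v u * G (t - u)) = (LINT u:{0..t}|lebesgue. v' u * G (t - u))"
    "(LINT u:{0..t}|lebesgue. q u) = (LINT u:{0..t}|lebesgue. q' u)" if t: "t \<in> {0..T}" for t
  proof -
    have sub: "set_integrable lebesgue {0..T} h \<Longrightarrow> set_integrable lebesgue {0..t} h" for h :: "real \<Rightarrow> real"
      using t by (auto intro: set_integrable_Icc_subset)
    have ae': "AE u\<in>{0..t} in lebesgue. v u = v' u \<and> q u = q' u"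
      using ae by eventually_elim (use t in auto)
    show "(LINT u:{0..t}|lebesgue. v u * (1 - G (t - u))) = (LINT u:{0..t}|lebesgue. v' u * (1 - G (t - u)))"
      by (intro set_integral_eq_AE set_integrable_mult_cdf[OF G] sub v) (use ae' in \<open>eventually_elim, auto\<close>)
    show "(LINT u:{0..t}|lebesgue. v u * G (t - u)) = (LINT u:{0..t}|lebesgue. v' u * G (t - u))"
      by (intro set_integral_eq_AE set_integrable_mult_cdf[OF G] sub v) (use ae' in \<open>eventually_elim, auto\<close>)
    show "(LINT u:{0..t}|lebesgue. q u) = (LINT u:{0..t}|lebesgue. q' u)"
      by (intro set_integral_eq_AE sub q) (use ae' in \<open>eventually_elim, auto\<close>)
  qed
  with assms(1) show ?thesis by (simp add: rate_equations_def)
qed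

text \<open>In the sum of (S1) and (S3) the kernels \<open>1 - G\<close> and \<open>G\<close> add up
  to one, as do \<open>1 - F\<close> and \<open>F\<close>, so \<open>\<rho>\<close> becomes a plain
  indefinite integral to which the level set lemma applies.\<close>

lemma rate_equations_busy:
  assumes "rate_equations \<rho> \<eta> d v q"
    and v: "set_integrable lebesgue {0..T} v" and d: "set_integrable lebesgue {0..T} d"
    and t: "0 \<le> t" "t \<le> T"
  shows "\<rho> t = min r0 1 + (LINT u:{0..t}|lebesgue. v u - d u)"
proof -
  have sub: "set_integrable lebesgue {0..t} v" "set_integrable lebesgue {0..t} d"
    using v d t by (auto intro: set_integrable_Icc_subset)
  have "(LINT u:{0..t}|lebesgue. v u) = (LINT u:{0..t}|lebesgue. v u * (1 - G (t - u)) + v u * G (t - u))"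
    by (simp add: algebra_simps)
  also have "\<dots> = (LINT u:{0..t}|lebesgue. v u * (1 - G (t - u))) + (LINT u:{0..t}|lebesgue. v u * G (t - u))"
    by (intro set_integral_add(2) set_integrable_mult_cdf[OF G] sub)
  finally have "(LINT u:{0..t}|lebesgue. v u - d u) =
      (LINT u:{0..t}|lebesgue. v u * (1 - G (t - u))) + (LINT u:{0..t}|lebesgue. v u * G (t - u))
      - (LINT u:{0..t}|lebesgue. d u)"
    using set_integral_diff(2)[OF sub] by simp
  moreover have "\<rho> t = min r0 1 - min r0 1 * F t + (LINT u:{0..t}|lebesgue. v u * (1 - G (t - u)))"
    "(LINT u:{0..t}|lebesgue. d u) = min r0 1 * F t + (LINT u:{0..t}|lebesgue. v u * G (t - u))"
    using assms(1) t by (auto simp: rate_equations_def right_diff_distrib[of _ 1 "F t"])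
  ultimately show ?thesis by linarith
qed

section \<open>Balance at the boundary levels and the case tables\<close>

text \<open>The derivative of \<open>\<rho>\<close> is \<open>entry_rate - d\<close> and that of
  \<open>\<eta>\<close> is \<open>queue_rate\<close>; they vanish a.e. on the level sets
  \<open>\<rho> = 1\<close>, respectively \<open>\<eta> = 0\<close> and
  \<open>\<eta> = \<beta>\<close>. The rest of the case table is algebra with (S4).\<close>

lemma AE_boundary_rates:
  assumes sol: "fluid_solution lam G F \<beta> r0 T \<rho> \<eta> d z1 z2 z3"
  shows "AE t\<in>{0..T} in lebesgue.
    (\<rho> t = 1 \<longrightarrow> z1 t * lam t + z2 t * d t = d t) \<and>
    (\<eta> t = 0 \<or> \<eta> t = \<beta> \<longrightarrow> (1 - z1 t) * z3 t * lam t = z2 t * d t)"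
proof -
  have reg: "regular_controls T d z1 z2 z3" and cb: "control_bounds \<beta> T \<rho> \<eta> z1 z2 z3"
    and "integral_equations lam G F r0 T \<rho> \<eta> d z1 z2 z3"
    using sol by (auto simp: fluid_solution_def)
  then have eq: "rate_equations \<rho> \<eta> d (entry_rate d z1 z2) (queue_rate d z1 z2 z3)"
    using integral_equations_iff_rate_equations by simp
  note int = controlled_rates_integrable[OF reg cb]
  have "AE t\<in>{0..T} in lebesgue. \<rho> t = 1 \<longrightarrow> entry_rate d z1 z2 t - d t = 0"
    by (rule AE_zero_on_level_set[OF set_integral_diff(1)[OF int(5) int(1)]])
       (rule rate_equations_busy[OF eq int(5) int(1)])
  moreover have "AE t\<in>{0..T} in lebesgue. \<eta> t = c \<longrightarrow> queue_rate d z1 z2 z3 t = 0" for c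
    by (rule AE_zero_on_level_set[OF int(6)]) (use eq in \<open>auto simp: rate_equations_def\<close>)
  from this[of 0] this[of \<beta>]
  have "AE t\<in>{0..T} in lebesgue. \<eta> t = 0 \<or> \<eta> t = \<beta> \<longrightarrow> queue_rate d z1 z2 z3 t = 0"
    by eventually_elim auto
  ultimately show ?thesis
    by eventually_elim (auto simp: entry_rate_def queue_rate_def)
qed

text \<open>For \<open>0 < \<beta>\<close>, (S4) forces \<open>z3 = 1\<close> at
  \<open>\<eta> = 0\<close> and \<open>z2 = 1\<close> at \<open>\<eta> = \<beta>\<close>, and each
  row then follows from the boundary balances. For \<open>\<beta> = 0\<close> neither value is
  forced on these coinciding levels.\<close>

lemma AE_case_table:
  assumes sol: "fluid_solution lam G F \<beta> r0 T \<rho> \<eta> d z1 z2 z3" and "0 < \<beta>"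
  shows "AE t\<in>{0..T} in lebesgue.
    case_table \<beta> (lam t) (\<rho> t) (\<eta> t) (d t) (z1 t) (z2 t) (z3 t)"
proof -
  have "control_bounds \<beta> T \<rho> \<eta> z1 z2 z3" "state_constraints \<beta> T \<rho> \<eta>"
    using sol by (auto simp: fluid_solution_def)
  with AE_boundary_rates[OF sol] show ?thesis
    unfolding control_bounds_def state_constraints_def
  proof eventually_elim
    case (elim t)
    show ?case
    proof
      assume t: "t \<in> {0..T}"
      note E = elim[rule_format, OF t]
      consider "\<rho> t < 1" "\<eta> t = 0" | "\<rho> t = 1" "\<eta> t = 0" | "\<rho> t = 1" "0 < \<eta> t" "\<eta> t < \<beta>"
        | "\<rho> t = 1" "\<eta> t = \<beta>"
        using E by force
      then show "case_table \<beta> (lam t) (\<rho> t) (\<eta> t) (d t) (z1 t) (z2 t) (z3 t)"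
        by cases (use E \<open>0 < \<beta>\<close> in \<open>auto simp: case_table_def algebra_simps\<close>)
    qed
  qed
qed

text \<open>The portion of the idle row that survives for \<open>\<beta> = 0\<close>:
  \<open>\<rho> < 1\<close> forces \<open>z1 = 1\<close>, and then the balance at
  \<open>\<eta> = 0\<close> leaves \<open>z2 * d = 0\<close>.\<close>

lemma AE_idle_rates:
  assumes sol: "fluid_solution lam G F \<beta> r0 T \<rho> \<eta> d z1 z2 z3"
  shows "AE t\<in>{0..T} in lebesgue. \<rho> t < 1 \<and> \<eta> t = 0 \<longrightarrow> z1 t = 1 \<and> z2 t * d t = 0"
proof -
  have "control_bounds \<beta> T \<rho> \<eta> z1 z2 z3"
    using sol by (auto simp: fluid_solution_def)
  with AE_boundary_rates[OF sol] show ?thesis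
    unfolding control_bounds_def by eventually_elim auto
qed

lemma rate_equations_continuous:
  assumes eq: "rate_equations \<rho> \<eta> d v q"
    and v: "set_integrable lebesgue {0..T} v" and d: "set_integrable lebesgue {0..T} d"
    and q: "set_integrable lebesgue {0..T} q"
  shows "continuous_on {0..T} \<rho>" "continuous_on {0..T} \<eta>"
proof -
  show "continuous_on {0..T} \<rho>"
  proof (rule continuous_on_eq)
    show "continuous_on {0..T} (\<lambda>t. min r0 1 + (LINT u:{0..t}|lebesgue. v u - d u))"
      by (intro continuous_on_add continuous_on_const continuous_on_set_integral set_integral_diff(1) v d)
  qed (simp add: rate_equations_busy[OF eq v d])
  show "continuous_on {0..T} \<eta>"
  proof (rule continuous_on_eq)
    show "continuous_on {0..T} (\<lambda>t. max (r0 - 1) 0 + (LINT u:{0..t}|lebesgue. q u))"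
      by (intro continuous_on_add continuous_on_const continuous_on_set_integral q)
  qed (use eq in \<open>simp add: rate_equations_def\<close>)
qed

lemma fluid_solution_rates:
  assumes "fluid_solution lam G F \<beta> r0 T \<rho> \<eta> d z1 z2 z3"
  shows "regular_controls T d z1 z2 z3" "control_bounds \<beta> T \<rho> \<eta> z1 z2 z3"
    "state_constraints \<beta> T \<rho> \<eta>"
    "rate_equations \<rho> \<eta> d (entry_rate d z1 z2) (queue_rate d z1 z2 z3)"
    "continuous_on {0..T} \<rho>" "continuous_on {0..T} \<eta>"
proof -
  show reg: "regular_controls T d z1 z2 z3" and cb: "control_bounds \<beta> T \<rho> \<eta> z1 z2 z3"
    and "state_constraints \<beta> T \<rho> \<eta>"
    using assms by (auto simp: fluid_solution_def)
  show eq: "rate_equations \<rho> \<eta> d (entry_rate d z1 z2) (queue_rate d z1 z2 z3)"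
    using assms integral_equations_iff_rate_equations[OF reg cb] by (simp add: fluid_solution_def)
  note int = controlled_rates_integrable[OF reg cb]
  show "continuous_on {0..T} \<rho>" "continuous_on {0..T} \<eta>"
    using rate_equations_continuous[OF eq int(5,1,6)] by auto
qed

text \<open>The canonical controls have a.e. the same entry and queue rates as the given ones, so
  the same \<open>\<rho>\<close>, \<open>\<eta>\<close> and \<open>d\<close> solve the equations.
  Only the full-queue row takes an argument, since there the truncation in
  \<open>min (d / l) 1\<close> must be inactive.\<close>

lemma ex_canonical_controls:
  assumes sol: "fluid_solution lam G F \<beta> r0 T \<rho> \<eta> d z1 z2 z3"
  shows "\<exists>w1 w2 w3. fluid_solution lam G F \<beta> r0 T \<rho> \<eta> d w1 w2 w3 \<and>
    (AE t\<in>{0..T} in lebesgue.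
      canonical_case_table \<beta> (lam t) (\<rho> t) (\<eta> t) (d t) (w1 t) (w2 t) (w3 t))"
proof -
  note S = fluid_solution_rates[OF sol]
  note int = controlled_rates_integrable[OF S(1,2)]
  \<comment> \<open>for \<open>\<beta> = 0\<close> the second and fourth rows overlap; these controls then follow the fourth\<close>
  define w1 where "w1 t = (if \<rho> t < 1 \<or> \<eta> t = 0 \<and> 0 < \<beta> then 1 else 0 :: real)" for t
  define w2 where "w2 t = 1 - w1 t" for t
  define w3 where "w3 t = (if \<rho> t = 1 \<and> \<eta> t = \<beta> \<and> lam t \<noteq> 0 then min (d t / lam t) 1 else 1)" for t
  have reg: "regular_controls T d w1 w2 w3"
  proof -
    let ?M = "lebesgue_on {0..T}"
    have [measurable]: "\<rho> \<in> borel_measurable ?M" "\<eta> \<in> borel_measurable ?M"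
      using S(5,6) by (auto intro: continuous_imp_measurable_on_sets_lebesgue)
    have *: "h \<in> borel_measurable ?M \<longleftrightarrow> set_borel_measurable lebesgue {0..T} h" for h :: "real \<Rightarrow> real"
      unfolding set_borel_measurable_def by (rule borel_measurable_restrict_space_iff) simp
    have [measurable]: "lam \<in> borel_measurable ?M" "d \<in> borel_measurable ?M"
      using lam_integrable int(1) by (auto simp: * set_borel_measurable_def set_integrable_def)
    have "w1 \<in> borel_measurable ?M" unfolding w1_def by measurable
    moreover from this have "w2 \<in> borel_measurable ?M" unfolding w2_def by measurable
    moreover have "w3 \<in> borel_measurable ?M" unfolding w3_def by measurable
    ultimately show ?thesis using int(1) by (simp add: regular_controls_def *)
  qed
  have "AE t\<in>{0..T} in lebesgue.
      (of_bool (\<rho> t < 1) \<le> w1 t \<and> w1 t \<le> 1 \<and> of_bool (\<eta> t > 0) \<le> w2 t \<and> w2 t \<le> 1 \<and>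
       of_bool (\<eta> t < \<beta>) \<le> w3 t \<and> w3 t \<le> 1) \<and>
      entry_rate d z1 z2 t = entry_rate d w1 w2 t \<and> queue_rate d z1 z2 z3 t = queue_rate d w1 w2 w3 t \<and>
      canonical_case_table \<beta> (lam t) (\<rho> t) (\<eta> t) (d t) (w1 t) (w2 t) (w3 t)" (is "AE t\<in>_ in _. ?P t")
    using AE_boundary_rates[OF sol] control_bounds_unit_interval[OF S(2)]
      S(2)[unfolded control_bounds_def] S(3)[unfolded state_constraints_def]
  proof eventually_elim
    case (elim t)
    show ?case
    proof
      assume t: "t \<in> {0..T}"
      note E = elim[rule_format, OF t]
      have l: "0 \<le> lam t" using lam_nonneg t by simp
      consider "\<rho> t < 1" "\<eta> t = 0" | "\<rho> t = 1" "\<eta> t = 0" "0 < \<beta>" | "\<rho> t = 1" "0 < \<eta> t" "\<eta> t < \<beta>"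
        | "\<rho> t = 1" "\<eta> t = \<beta>"
        using E by force
      then show "?P t"
      proof cases
        case 4
        \<comment> \<open>Combining both balances writes \<open>d\<close> as a sum of two
          nonnegative shares of \<open>lam\<close>, so \<open>0 \<le> d \<le> lam\<close>. Hence
          \<open>w3 * lam = d\<close>, also where \<open>lam\<close> is zero, as \<open>d\<close> is
          zero there too.\<close>
        have "d t = z1 t * lam t + (1 - z1 t) * z3 t * lam t" using E 4 by simp
        moreover have "0 \<le> z1 t * lam t" "0 \<le> (1 - z1 t) * z3 t * lam t" using E l by auto
        moreover have "(1 - z1 t) * z3 t * lam t \<le> (1 - z1 t) * 1 * lam t"
          using E l by (intro mult_right_mono mult_left_mono) auto
        ultimately have d: "0 \<le> d t" "d t \<le> lam t" by (auto simp: algebra_simps)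
        then have "w3 t * lam t = d t" "0 \<le> w3 t" "w3 t \<le> 1"
          using 4 l by (auto simp: w3_def min_def divide_simps)
        moreover have "w1 t = 0" "w2 t = 1" using 4 by (auto simp: w1_def w2_def)
        ultimately show ?thesis
          using E 4 by (auto simp: entry_rate_def queue_rate_def canonical_case_table_def w3_def)
      next
        case 1
        then have "w1 t = 1" "w2 t = 0" "w3 t = 1" by (auto simp: w1_def w2_def w3_def)
        moreover have "z1 t = 1" "z2 t * d t = 0" using E 1 by auto
        ultimately show ?thesis
          using 1 by (simp add: entry_rate_def queue_rate_def canonical_case_table_def)
      next
        case 2
        then have "w1 t = 1" "w2 t = 0" "w3 t = 1" by (auto simp: w1_def w2_def w3_def)
        moreover have "z3 t = 1" using E 2 by auto
        moreover from this have "z2 t * d t = (1 - z1 t) * lam t" using E 2 by simp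
        ultimately show ?thesis
          using 2 by (simp add: entry_rate_def queue_rate_def canonical_case_table_def algebra_simps)
      next
        case 3
        then have "w1 t = 0" "w2 t = 1" "w3 t = 1" by (auto simp: w1_def w2_def w3_def)
        moreover have "z2 t = 1" "z3 t = 1" using E 3 by auto
        moreover from this have "z1 t * lam t = 0" using E 3 by auto
        ultimately show ?thesis
          using 3 by (simp add: entry_rate_def queue_rate_def canonical_case_table_def algebra_simps)
      qed
    qed
  qed
  then have cb: "control_bounds \<beta> T \<rho> \<eta> w1 w2 w3"
    and rates: "AE t\<in>{0..T} in lebesgue. entry_rate d z1 z2 t = entry_rate d w1 w2 t
        \<and> queue_rate d z1 z2 z3 t = queue_rate d w1 w2 w3 t"
    and table: "AE t\<in>{0..T} in lebesgue.
        canonical_case_table \<beta> (lam t) (\<rho> t) (\<eta> t) (d t) (w1 t) (w2 t) (w3 t)"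
    unfolding control_bounds_def by (auto elim!: eventually_mono)
  note wint = controlled_rates_integrable[OF reg cb]
  have "rate_equations \<rho> \<eta> d (entry_rate d w1 w2) (queue_rate d w1 w2 w3)"
    by (rule rate_equations_cong[OF S(4) int(5) wint(5) int(6) wint(6) rates])
  then have "integral_equations lam G F r0 T \<rho> \<eta> d w1 w2 w3"
    using integral_equations_iff_rate_equations[OF reg cb] by simp
  with reg cb S(3) table show ?thesis unfolding fluid_solution_def by blast
qed

section \<open>Nonnegative departures and sufficiency of the canonical table\<close>

text \<open>The sign of \<open>d\<close> has to be derived from the equations. The last hypothesis
  says that \<open>v\<close> is no more negative than \<open>d\<close>; by (S3) the negative part
  \<open>n\<close> of \<open>d\<close> is then a.e. at most \<open>cg\<close> times its own
  primitive \<open>N\<close>, and \<open>N 0 = 0\<close> forces \<open>n\<close> to vanish.\<close>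

lemma AE_departure_rate_nonneg:
  assumes eq: "rate_equations \<rho> \<eta> d v q"
    and v: "set_integrable lebesgue {0..T} v" and d: "set_integrable lebesgue {0..T} d"
    and vd: "AE t\<in>{0..T} in lebesgue. min (d t) 0 \<le> v t"
  shows "AE t\<in>{0..T} in lebesgue. 0 \<le> d t"
proof -
  define n where "n u = max 0 (- d u)" for u
  define N where "N t = (LINT u:{0..t}|lebesgue. n u)" for t
  have n0: "0 \<le> n u" for u by (simp add: n_def)
  have n: "set_integrable lebesgue {0..T} n"
  proof -
    have "set_integrable lebesgue {0..T} (\<lambda>u. (1/2) * (\<bar>d u\<bar> - d u))"
      by (intro set_integrable_mult_right set_integral_diff(1) set_integrable_abs d)
    moreover have "(\<lambda>u. (1/2) * (\<bar>d u\<bar> - d u)) = n"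
    proof
      show "(1/2) * (\<bar>d u\<bar> - d u) = n u" for u
        by (cases "0 \<le> d u") (simp_all add: n_def)
    qed
    ultimately show ?thesis by metis
  qed
  have Ndiff: "N b - N a = (LINT u:{a..b}|lebesgue. n u)" if "0 \<le> a" "a \<le> b" "b \<le> T" for a b
    using set_integral_Icc_combine[OF n that] by (simp add: N_def)
  have int_n0: "0 \<le> (LINT u:A|lebesgue. n u)" for A
    unfolding set_lebesgue_integral_def by (intro integral_nonneg_AE) (simp add: n0)
  have Nmono: "N a \<le> N b" if "0 \<le> a" "a \<le> b" "b \<le> T" for a b
    using Ndiff[OF that] int_n0[of "{a..b}"] by simp
  have monoF: "F x \<le> F y" if "x \<le> y" for x y
    using cdf_with_density_props(1)[OF F] that by (simp add: mono_def)
  have monoG: "G x \<le> G y" if "x \<le> y" for x y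
    using cdf_with_density_props(1)[OF G] that by (simp add: mono_def)
  \<comment> \<open>\<open>G\<close> is \<open>cg\<close>-Lipschitz, so \<open>d \<ge> - cg * N b\<close> up to time \<open>b\<close>; Gronwall's inequality for \<open>N\<close> is
    then run in steps of length \<open>w\<close> with \<open>cg * w < 1\<close>\<close>
  have incr: "- (cg * (y - x) * N y) \<le> (LINT u:{x..y}|lebesgue. d u)" if xy: "0 \<le> x" "x \<le> y" "y \<le> T" for x y
  proof -
    have vy: "set_integrable lebesgue {0..y} v" and vx: "set_integrable lebesgue {0..x} v"
      and ny: "set_integrable lebesgue {0..y} n"
      using xy by (auto intro: set_integrable_Icc_subset[OF v] set_integrable_Icc_subset[OF n])
    \<comment> \<open>Since \<open>G\<close> is zero on nonpositive arguments, the integral up to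
      \<open>x\<close> can be taken up to \<open>y\<close>, which allows the two kernels to be
      compared under one integral.\<close>
    have eqx: "(\<lambda>u. indicator {0..y} u *\<^sub>R (v u * G (x - u))) = (\<lambda>u. indicator {0..x} u *\<^sub>R (v u * G (x - u)))"
      using xy cdf_with_density_props(4)[OF G] by (auto simp: fun_eq_iff indicator_def)
    have ix: "set_integrable lebesgue {0..y} (\<lambda>u. v u * G (x - u))"
      using set_integrable_mult_cdf(1)[OF G vx] unfolding set_integrable_def eqx .
    have iy: "set_integrable lebesgue {0..y} (\<lambda>u. v u * G (y - u))"
      by (rule set_integrable_mult_cdf(1)[OF G vy])
    have "- (cg * (y - x) * N y) = (LINT u:{0..y}|lebesgue. - (cg * (y - x)) * n u)"
      by (subst set_integral_mult_right) (simp add: N_def)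
    also have "\<dots> \<le> (LINT u:{0..y}|lebesgue. v u * G (y - u) - v u * G (x - u))"
    proof (rule set_integral_mono_AE)
      show "set_integrable lebesgue {0..y} (\<lambda>u. - (cg * (y - x)) * n u)"
        by (intro set_integrable_mult_right ny)
      show "set_integrable lebesgue {0..y} (\<lambda>u. v u * G (y - u) - v u * G (x - u))"
        by (rule set_integral_diff(1)[OF iy ix])
      show "AE u\<in>{0..y} in lebesgue. - (cg * (y - x)) * n u \<le> v u * G (y - u) - v u * G (x - u)"
        using vd
      proof eventually_elim
        case (elim u)
        show ?case
        proof
          assume u: "u \<in> {0..y}"
          let ?g = "G (y - u) - G (x - u)"
          have g: "0 \<le> ?g" "?g \<le> cg * (y - x)"
            using monoG[of "x - u" "y - u"] cdf_with_density_lipschitz[OF G g_le, of "x - u" "y - u"] xy by auto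
          have "- n u \<le> v u" using elim u xy by (auto simp: n_def min_def max_def split: if_splits)
          then have "- n u * ?g \<le> v u * ?g" using g by (intro mult_right_mono)
          moreover have "n u * ?g \<le> n u * (cg * (y - x))" using g n0 by (intro mult_left_mono)
          ultimately show "- (cg * (y - x)) * n u \<le> v u * G (y - u) - v u * G (x - u)"
            by (simp add: algebra_simps)
        qed
      qed
    qed
    also have "\<dots> = (LINT u:{0..y}|lebesgue. v u * G (y - u)) - (LINT u:{0..x}|lebesgue. v u * G (x - u))"
    proof -
      have "(LINT u:{0..y}|lebesgue. v u * G (x - u)) = (LINT u:{0..x}|lebesgue. v u * G (x - u))"
        unfolding set_lebesgue_integral_def eqx ..
      then show ?thesis using set_integral_diff(2)[OF iy ix] by simp
    qed
    also have "\<dots> \<le> (LINT u:{0..y}|lebesgue. d u) - (LINT u:{0..x}|lebesgue. d u)"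
    proof -
      \<comment> \<open>The contribution of the initially busy servers is nondecreasing, so dropping
        it only lowers the increment of departures.\<close>
      have "min r0 1 * F x \<le> min r0 1 * F y" using r0 monoF[OF xy(2)] by (intro mult_left_mono) auto
      moreover have "(LINT u:{0..s}|lebesgue. d u) = min r0 1 * F s + (LINT u:{0..s}|lebesgue. v u * G (s - u))"
        if "s \<in> {0..T}" for s
        using eq that by (simp add: rate_equations_def)
      from this[of x] this[of y] have "(LINT u:{0..x}|lebesgue. d u) = min r0 1 * F x + (LINT u:{0..x}|lebesgue. v u * G (x - u))"
        "(LINT u:{0..y}|lebesgue. d u) = min r0 1 * F y + (LINT u:{0..y}|lebesgue. v u * G (y - u))"
        using xy by auto
      ultimately show ?thesis by linarith
    qed
    also have "\<dots> = (LINT u:{x..y}|lebesgue. d u)"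
      using set_integral_Icc_combine[OF d xy] by simp
    finally show ?thesis .
  qed
  have step: "N b - N a \<le> cg * (b - a) * N b" if ab: "0 \<le> a" "a \<le> b" "b \<le> T" for a b
  proof -
    have const: "set_integrable lebesgue {x..y} (\<lambda>u. c)" for x y c :: real
      by (intro absolutely_integrable_continuous_real continuous_on_const)
    have da: "set_integrable lebesgue {a..b} d" and na: "set_integrable lebesgue {a..b} n"
      using ab by (auto intro: set_integrable_Icc_subset[OF d] set_integrable_Icc_subset[OF n])
    have "AE u\<in>{a..b} in lebesgue. 0 \<le> d u + cg * N b"
    proof (rule AE_nonneg_if_interval_integrals_nonneg)
      show "set_integrable lebesgue {a..b} (\<lambda>u. d u + cg * N b)"
        by (intro set_integral_add(1) da const)
      fix x y assume xy: "a \<le> x" "x \<le> y" "y \<le> b"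
      have "(LINT u:{x..y}|lebesgue. d u + cg * N b) = (LINT u:{x..y}|lebesgue. d u) + cg * N b * (y - x)"
        using set_integral_add(2)[OF set_integrable_Icc_subset[OF da xy(1,3)] const] xy
        by (simp add: set_lebesgue_integral_def)
      moreover have "cg * (y - x) * N y \<le> cg * (y - x) * N b"
        using xy ab cg Nmono by (intro mult_left_mono) auto
      ultimately show "0 \<le> (LINT u:{x..y}|lebesgue. d u + cg * N b)"
        using incr[of x y] xy ab by (simp add: algebra_simps)
    qed
    then have "AE u\<in>{a..b} in lebesgue. n u \<le> cg * N b"
    proof eventually_elim
      case (elim u)
      have "0 \<le> cg * N b" using cg int_n0 by (simp add: N_def)
      then show ?case using elim by (auto simp: n_def)
    qed
    then have "(LINT u:{a..b}|lebesgue. n u) \<le> (LINT u:{a..b}|lebesgue. cg * N b)"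
      by (intro set_integral_mono_AE na const)
    also have "\<dots> = cg * (b - a) * N b" using ab by (simp add: set_lebesgue_integral_def)
    finally show ?thesis using Ndiff[OF ab] by simp
  qed
  obtain M :: nat where M: "cg * T < M" using reals_Archimedean2 by blast
  moreover have "0 < cg * T" using cg T by simp
  ultimately have M0: "0 < real M" by linarith
  define w where "w = T / M"
  have w: "0 < w" "cg * w < 1" using M M0 T by (auto simp: w_def field_simps)
  have "N (real k * w) = 0" if "k \<le> M" for k
    using that
  proof (induction k)
    case 0
    then show ?case by (simp add: N_def set_integral_singleton_lebesgue)
  next
    case (Suc k)
    have "real (Suc k) * w \<le> real M * w" using Suc w by (intro mult_right_mono) auto
    then have le: "real (Suc k) * w \<le> T" using M0 by (simp add: w_def)
    have "N (real (Suc k) * w) - N (real k * w) \<le> cg * (real (Suc k) * w - real k * w) * N (real (Suc k) * w)"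
      using w le by (intro step) (auto simp: algebra_simps)
    \<comment> \<open>The estimate bounds the increment by \<open>N\<close> at the new time, so that
      term is absorbed on the left; \<open>cg * w < 1\<close> keeps the coefficient
      positive.\<close>
    then have "(1 - cg * w) * N (real (Suc k) * w) \<le> 0"
      using Suc by (simp add: algebra_simps)
    then have "N (real (Suc k) * w) \<le> 0"
      using w by (simp add: mult_le_0_iff)
    then show ?case using int_n0[of "{0..real (Suc k) * w}"] by (simp add: N_def)
  qed
  from this[of M] have NT: "N T = 0" using M0 by (simp add: w_def)
  have "AE u\<in>{0..T} in lebesgue. n u = 0"
  proof (rule AE_zero_if_interval_integrals_zero[OF n])
    fix t assume "0 \<le> t" "t \<le> T"
    then show "(LINT u:{0..t}|lebesgue. n u) = 0"
      using Nmono[of t T] NT int_n0[of "{0..t}"] by (simp add: N_def)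
  qed
  then show ?thesis by eventually_elim (auto simp: n_def)
qed

text \<open>The table itself contains every constraint of (S5) except \<open>0 \<le> \<rho>\<close>.
  That one comes from (S1) once the entry rate is known to be nonnegative.\<close>

lemma canonical_table_imp_fluid_solution:
  assumes reg: "regular_controls T d z1 z2 z3"
    and "integral_equations lam G F r0 T \<rho> \<eta> d z1 z2 z3"
    and cb: "control_bounds \<beta> T \<rho> \<eta> z1 z2 z3"
    and table: "AE t\<in>{0..T} in lebesgue.
      canonical_case_table \<beta> (lam t) (\<rho> t) (\<eta> t) (d t) (z1 t) (z2 t) (z3 t)"
  shows "fluid_solution lam G F \<beta> r0 T \<rho> \<eta> d z1 z2 z3"
proof -
  have eq: "rate_equations \<rho> \<eta> d (entry_rate d z1 z2) (queue_rate d z1 z2 z3)"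
    using assms integral_equations_iff_rate_equations by simp
  note int = controlled_rates_integrable[OF reg cb]
  \<comment> \<open>The entry rate is \<open>lam\<close> in the first two rows and \<open>d\<close>
    in the last two.\<close>
  have rate: "AE t\<in>{0..T} in lebesgue. min (d t) 0 \<le> entry_rate d z1 z2 t"
    using table
  proof eventually_elim
    case (elim t)
    then show ?case using lam_nonneg[of t] by (auto simp: canonical_case_table_def entry_rate_def)
  qed
  from AE_departure_rate_nonneg[OF eq int(5,1) this] rate
  have pos: "AE t\<in>{0..T} in lebesgue. 0 \<le> entry_rate d z1 z2 t"
    by eventually_elim auto
  have "0 \<le> \<rho> t" if t: "t \<in> {0..T}" for t
  proof -
    have "0 \<le> (LINT u:{0..t}|lebesgue. entry_rate d z1 z2 u * (1 - G (t - u)))"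
      unfolding set_lebesgue_integral_def
    proof (rule integral_nonneg_AE)
      show "AE u in lebesgue. 0 \<le> indicator {0..t} u *\<^sub>R (entry_rate d z1 z2 u * (1 - G (t - u)))"
        using pos by eventually_elim
          (use t cdf_with_density_props(3)[OF G] in \<open>auto simp: indicator_def\<close>)
    qed
    moreover have "0 \<le> min r0 1 * (1 - F t)"
      using r0 cdf_with_density_props(3)[OF F] by auto
    ultimately show ?thesis using eq t by (simp add: rate_equations_def)
  qed
  note \<rho>_nonneg = this
  have "state_constraints \<beta> T \<rho> \<eta>"
    unfolding state_constraints_def using table
  proof eventually_elim
    case (elim t)
    then show ?case using \<rho>_nonneg[of t] \<beta> by (auto simp: canonical_case_table_def)
  qed
  with assms show ?thesis by (simp add: fluid_solution_def)
qed

section \<open>Content as a reflected path, and uniqueness\<close>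

text \<open>The rate of arrivals that are not lost, whether they enter service or the queue; the
  excess \<open>lam - admission_rate\<close> acts as the reflection term.\<close>

definition admission_rate :: "(real \<Rightarrow> real) \<Rightarrow> (real \<Rightarrow> real) \<Rightarrow> real \<Rightarrow> real" where
  "admission_rate z1 z3 u = z1 u * lam u + (1 - z1 u) * z3 u * lam u"

text \<open>Below the barrier \<open>1 + \<beta>\<close> either a server is idle or the queue has
  room, so \<open>z1 = 1\<close> or \<open>z3 = 1\<close> and nothing is lost.\<close>

lemma AE_admission_rate:
  assumes "control_bounds \<beta> T \<rho> \<eta> z1 z2 z3" "state_constraints \<beta> T \<rho> \<eta>"
  shows "AE t\<in>{0..T} in lebesgue. admission_rate z1 z3 t \<le> lam t \<and>
    (\<rho> t + \<eta> t < 1 + \<beta> \<longrightarrow> admission_rate z1 z3 t = lam t)"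
  using control_bounds_unit_interval[OF assms(1)]
    assms(1)[unfolded control_bounds_def] assms(2)[unfolded state_constraints_def]
proof eventually_elim
  case (elim t)
  show ?case
  proof
    assume t: "t \<in> {0..T}"
    note E = elim[rule_format, OF t]
    have "(1 - z1 t) * z3 t * lam t \<le> (1 - z1 t) * 1 * lam t"
      using E lam_nonneg[of t] t by (intro mult_right_mono mult_left_mono) auto
    then have "admission_rate z1 z3 t \<le> lam t" by (simp add: admission_rate_def algebra_simps)
    moreover have "admission_rate z1 z3 t = lam t" if "\<rho> t + \<eta> t < 1 + \<beta>"
    proof -
      consider "\<rho> t < 1" | "\<eta> t < \<beta>" using \<open>\<rho> t + \<eta> t < 1 + \<beta>\<close> by linarith
      then have "z1 t = 1 \<or> z3 t = 1" using E by cases auto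
      then show ?thesis by (auto simp: admission_rate_def algebra_simps)
    qed
    ultimately show "admission_rate z1 z3 t \<le> lam t \<and>
      (\<rho> t + \<eta> t < 1 + \<beta> \<longrightarrow> admission_rate z1 z3 t = lam t)" by blast
  qed
qed

text \<open>Moves from queue to server cancel in the sum of \<open>\<rho>\<close> and
  \<open>\<eta>\<close>, and the two initial values add up to \<open>r0\<close>.\<close>

lemma content_eq:
  assumes sol: "fluid_solution lam G F \<beta> r0 T \<rho> \<eta> d z1 z2 z3" and t: "t \<in> {0..T}"
  shows "\<rho> t + \<eta> t = r0 + (LINT u:{0..t}|lebesgue. admission_rate z1 z3 u) - (LINT u:{0..t}|lebesgue. d u)"
    and "set_integrable lebesgue {0..T} (admission_rate z1 z3)"
proof -
  note S = fluid_solution_rates[OF sol]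
  note int = controlled_rates_integrable[OF S(1,2)]
  show a: "set_integrable lebesgue {0..T} (admission_rate z1 z3)"
    using set_integral_add(1)[OF int(2,4)] by (simp add: admission_rate_def[abs_def])
  have sub: "set_integrable lebesgue {0..T} h \<Longrightarrow> set_integrable lebesgue {0..t} h" for h :: "real \<Rightarrow> real"
    using t by (auto intro: set_integrable_Icc_subset)
  have "\<rho> t + \<eta> t = min r0 1 + max (r0 - 1) 0
      + ((LINT u:{0..t}|lebesgue. entry_rate d z1 z2 u - d u) + (LINT u:{0..t}|lebesgue. queue_rate d z1 z2 z3 u))"
    using rate_equations_busy[OF S(4) int(5,1), of t] S(4) t by (simp add: rate_equations_def)
  also have "min r0 1 + max (r0 - 1) 0 = r0" by (simp add: min_def max_def)
  also have "(LINT u:{0..t}|lebesgue. entry_rate d z1 z2 u - d u) + (LINT u:{0..t}|lebesgue. queue_rate d z1 z2 z3 u)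
      = (LINT u:{0..t}|lebesgue. (entry_rate d z1 z2 u - d u) + queue_rate d z1 z2 z3 u)"
    by (intro set_integral_add(2)[symmetric] set_integral_diff(1) sub int)
  also have "\<dots> = (LINT u:{0..t}|lebesgue. admission_rate z1 z3 u - d u)"
    by (simp add: entry_rate_def queue_rate_def admission_rate_def algebra_simps)
  also have "\<dots> = (LINT u:{0..t}|lebesgue. admission_rate z1 z3 u) - (LINT u:{0..t}|lebesgue. d u)"
    by (intro set_integral_diff(2) sub a int)
  finally show "\<rho> t + \<eta> t = r0 + (LINT u:{0..t}|lebesgue. admission_rate z1 z3 u) - (LINT u:{0..t}|lebesgue. d u)"
    by simp
qed

text \<open>By complementarity either \<open>\<eta> = 0\<close> with \<open>\<rho> \<le> 1\<close>,
  or \<open>\<rho> = 1\<close> with \<open>\<eta> \<ge> 0\<close>. This holds a.e., and continuity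
  extends it to every time.\<close>

lemma busy_eq_min_content:
  assumes sol: "fluid_solution lam G F \<beta> r0 T \<rho> \<eta> d z1 z2 z3" and t: "t \<in> {0..T}"
  shows "\<rho> t = min (\<rho> t + \<eta> t) 1"
proof -
  note S = fluid_solution_rates[OF sol]
  have "\<rho> t - min (\<rho> t + \<eta> t) 1 = 0"
  proof (rule continuous_on_AE_zero_imp_zero[OF T _ _ t])
    show "continuous_on {0..T} (\<lambda>t. \<rho> t - min (\<rho> t + \<eta> t) 1)"
      by (intro continuous_intros S(5,6))
    show "AE t\<in>{0..T} in lebesgue. \<rho> t - min (\<rho> t + \<eta> t) 1 = 0"
      using S(3)[unfolded state_constraints_def]
      by eventually_elim (auto simp: min_def)
  qed
  then show ?thesis by simp
qed

text \<open>A one-sided comparison of reflected paths; exchanging the solutions gives the other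
  side. The factor 2 arises because the departure difference is counted at \<open>t\<close> and at
  the last time where the contents were in the opposite order.\<close>

lemma content_difference_le:
  assumes sol: "fluid_solution lam G F \<beta> r0 T \<rho> \<eta> d z1 z2 z3"
    and sol': "fluid_solution lam G F \<beta> r0 T \<rho>' \<eta>' d' z1' z2' z3'"
    and t: "t \<in> {0..T}"
    and B: "\<And>s. s \<in> {0..t} \<Longrightarrow> \<bar>(LINT u:{0..s}|lebesgue. d u) - (LINT u:{0..s}|lebesgue. d' u)\<bar> \<le> B"
  shows "(\<rho> t + \<eta> t) - (\<rho>' t + \<eta>' t) \<le> 2 * B"
proof (rule ccontr)
  assume neg: "\<not> ?thesis"
  note S = fluid_solution_rates[OF sol] and S' = fluid_solution_rates[OF sol']
  define X where "X s = \<rho> s + \<eta> s" for s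
  define X' where "X' s = \<rho>' s + \<eta>' s" for s
  define D where "D s = (LINT u:{0..s}|lebesgue. d u)" for s
  define D' where "D' s = (LINT u:{0..s}|lebesgue. d' u)" for s
  let ?a = "admission_rate z1 z3" and ?a' = "admission_rate z1' z3'"
  have a: "set_integrable lebesgue {0..T} ?a" and a': "set_integrable lebesgue {0..T} ?a'"
    using content_eq(2)[OF sol t] content_eq(2)[OF sol' t] by auto
  have X: "X s = r0 + (LINT u:{0..s}|lebesgue. ?a u) - D s" and X': "X' s = r0 + (LINT u:{0..s}|lebesgue. ?a' u) - D' s"
    if "s \<in> {0..T}" for s
    using content_eq(1)[OF sol that] content_eq(1)[OF sol' that] by (auto simp: X_def X'_def D_def D'_def)
  have B: "\<bar>D s - D' s\<bar> \<le> B" if "s \<in> {0..t}" for s using B[OF that] by (simp add: D_def D'_def)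
  have "0 \<le> B" using B[of 0] t by auto
  let ?Z = "{0..t} \<inter> ({0..T} \<inter> (\<lambda>s. X s - X' s) -` {..0})"
  have "continuous_on {0..T} (\<lambda>s. X s - X' s)"
    unfolding X_def X'_def by (intro continuous_intros S(5,6) S'(5,6))
  then have "closed ({0..T} \<inter> (\<lambda>s. X s - X' s) -` {..0})"
    by (rule continuous_closed_preimage) auto
  then have "compact ?Z" by (rule compact_Int_closed[OF compact_Icc])
  moreover have "0 \<in> ?Z"
    using t X[of 0] X'[of 0] by (simp add: D_def D'_def set_integral_singleton_lebesgue)
  \<comment> \<open>after the last time \<open>s\<close> at which \<open>X \<le> X'\<close>, the smaller \<open>X'\<close> stays below the barrier and admits
    everything\<close>
  ultimately obtain s where s: "s \<in> ?Z" "\<And>u. u \<in> ?Z \<Longrightarrow> u \<le> s"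
    using compact_attains_sup[of ?Z] by blast
  have st: "0 \<le> s" "s \<le> t" "t \<le> T" using s t by auto
  have above: "X' u < X u" if "s < u" "u \<le> t" for u
    using s(2)[of u] that st by force
  have "AE u\<in>{s..t} in lebesgue. ?a u \<le> ?a' u"
  proof -
    \<comment> \<open>The strict ordering of the contents is only available after \<open>s\<close>,
      so the endpoint is discarded as a null set.\<close>
    have "AE u in lebesgue. u \<noteq> s" by (intro AE_completion AE_lborel_singleton)
    with AE_admission_rate[OF S(2,3)] AE_admission_rate[OF S'(2,3)] S(3)[unfolded state_constraints_def]
    show ?thesis
    proof eventually_elim
      case (elim u)
      show ?case
      proof
        assume u: "u \<in> {s..t}"
        then have uT: "u \<in> {0..T}" and us: "s < u" "u \<le> t" using st elim by auto
        note E = elim(1-3)[rule_format, OF uT]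
        \<comment> \<open>The larger content is at most \<open>1 + \<beta>\<close> by (S5), so the
          strictly smaller one is below the barrier.\<close>
        have "\<rho>' u + \<eta>' u < 1 + \<beta>" using above[OF us] E by (simp add: X_def X'_def)
        then show "?a u \<le> ?a' u" using E by auto
      qed
    qed
  qed
  then have "(LINT u:{s..t}|lebesgue. ?a u) \<le> (LINT u:{s..t}|lebesgue. ?a' u)"
    using st by (intro set_integral_mono_AE set_integrable_Icc_subset[OF a] set_integrable_Icc_subset[OF a'])
  then have "X t - X s + (D t - D s) \<le> X' t - X' s + (D' t - D' s)"
    using X[of t] X[of s] X'[of t] X'[of s] st
      set_integral_Icc_combine[OF a st] set_integral_Icc_combine[OF a' st] by simp
  moreover have "X s \<le> X' s" using s by simp
  ultimately have "X t - X' t \<le> 2 * B" using B[of t] B[of s] st by auto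
  with neg show False by (simp add: X_def X'_def)
qed

text \<open>The weighted supremum \<open>K\<close> of the departure difference
  \<open>\<Delta>\<close> is attained at some \<open>t0\<close> by continuity. Feeding the resulting
  bounds into the convolution form of (S3) at \<open>t0\<close> gives back at most half of
  \<open>\<bar>\<Delta> t0\<bar>\<close>.\<close>

lemma departures_unique:
  assumes sol: "fluid_solution lam G F \<beta> r0 T \<rho> \<eta> d z1 z2 z3"
    and sol': "fluid_solution lam G F \<beta> r0 T \<rho>' \<eta>' d' z1' z2' z3'"
    and t: "t \<in> {0..T}"
  shows "(LINT u:{0..t}|lebesgue. d u) = (LINT u:{0..t}|lebesgue. d' u)"
proof -
  note S = fluid_solution_rates[OF sol] and S' = fluid_solution_rates[OF sol']
  note int = controlled_rates_integrable[OF S(1,2)] and int' = controlled_rates_integrable[OF S'(1,2)]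
  \<comment> \<open>\<open>3 * cg / \<mu> = 1 / 2\<close> is the contraction constant\<close>
  define \<mu> where "\<mu> = 6 * cg"
  have \<mu>: "0 < \<mu>" using cg by (simp add: \<mu>_def)
  define v where "v u = entry_rate d z1 z2 u - entry_rate d' z1' z2' u" for u
  have v: "set_integrable lebesgue {0..T} v"
    unfolding v_def by (rule set_integral_diff(1)[OF int(5) int'(5)])
  define \<Delta> where "\<Delta> s = (LINT u:{0..s}|lebesgue. d u) - (LINT u:{0..s}|lebesgue. d' u)" for s
  have cont: "continuous_on {0..T} \<Delta>"
    unfolding \<Delta>_def by (intro continuous_on_diff continuous_on_set_integral int(1) int'(1))
  have "continuous_on {0..T} (\<lambda>s. exp (- \<mu> * s) * \<bar>\<Delta> s\<bar>)"
    by (intro continuous_intros cont)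
  then obtain t0 where t0: "t0 \<in> {0..T}"
    and max: "\<And>s. s \<in> {0..T} \<Longrightarrow> exp (- \<mu> * s) * \<bar>\<Delta> s\<bar> \<le> exp (- \<mu> * t0) * \<bar>\<Delta> t0\<bar>"
    using continuous_attains_sup[of "{0..T}" "\<lambda>s. exp (- \<mu> * s) * \<bar>\<Delta> s\<bar>"] T by auto
  define K where "K = exp (- \<mu> * t0) * \<bar>\<Delta> t0\<bar>"
  have K0: "0 \<le> K" by (simp add: K_def)
  have \<Delta>_le: "\<bar>\<Delta> s\<bar> \<le> K * exp (\<mu> * s)" if "s \<in> {0..T}" for s
  proof -
    have "exp (\<mu> * s) * (exp (- \<mu> * s) * \<bar>\<Delta> s\<bar>) \<le> exp (\<mu> * s) * K"
      using max[OF that] by (intro mult_left_mono) (auto simp: K_def)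
    also have "exp (\<mu> * s) * (exp (- \<mu> * s) * \<bar>\<Delta> s\<bar>) = \<bar>\<Delta> s\<bar>"
      by (simp add: exp_minus field_simps)
    finally show ?thesis by (simp add: mult.commute)
  qed
  define y where "y s = (LINT u:{0..s}|lebesgue. v u)" for s
  \<comment> \<open>Here \<open>y = (\<rho> - \<rho>') + \<Delta>\<close>: the comparison of
    contents contributes 2 and \<open>\<Delta>\<close> itself contributes 1 to the constant
    3.\<close>
  have y_le: "\<bar>y s\<bar> \<le> 3 * K * exp (\<mu> * s)" if s: "s \<in> {0..T}" for s
  proof -
    have sub: "set_integrable lebesgue {0..T} h \<Longrightarrow> set_integrable lebesgue {0..s} h" for h :: "real \<Rightarrow> real"
      using s by (auto intro: set_integrable_Icc_subset)
    have "y s = (LINT u:{0..s}|lebesgue. entry_rate d z1 z2 u) - (LINT u:{0..s}|lebesgue. entry_rate d' z1' z2' u)"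
      unfolding y_def v_def by (intro set_integral_diff(2) sub int int')
    moreover have "\<rho> s = min r0 1 + (LINT u:{0..s}|lebesgue. entry_rate d z1 z2 u) - (LINT u:{0..s}|lebesgue. d u)"
      using rate_equations_busy[OF S(4) int(5,1), of s] set_integral_diff(2)[OF sub[OF int(5)] sub[OF int(1)]] s
      by simp
    moreover have "\<rho>' s = min r0 1 + (LINT u:{0..s}|lebesgue. entry_rate d' z1' z2' u) - (LINT u:{0..s}|lebesgue. d' u)"
      using rate_equations_busy[OF S'(4) int'(5,1), of s] set_integral_diff(2)[OF sub[OF int'(5)] sub[OF int'(1)]] s
      by simp
    ultimately have y: "y s = (\<rho> s - \<rho>' s) + \<Delta> s" by (simp add: \<Delta>_def)
    \<comment> \<open>The comparison needs a bound on all of \<open>{0..s}\<close>; the weight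
      \<open>exp (\<mu> * u)\<close> increases, so its value at \<open>s\<close> serves.\<close>
    have B: "\<bar>\<Delta> u\<bar> \<le> K * exp (\<mu> * s)" if "u \<in> {0..s}" for u
    proof -
      have "\<bar>\<Delta> u\<bar> \<le> K * exp (\<mu> * u)" using \<Delta>_le that s by auto
      also have "\<dots> \<le> K * exp (\<mu> * s)" using that \<mu> K0 by (intro mult_left_mono) auto
      finally show ?thesis .
    qed
    have "(\<rho> s + \<eta> s) - (\<rho>' s + \<eta>' s) \<le> 2 * (K * exp (\<mu> * s))"
      by (rule content_difference_le[OF sol sol' s]) (use B in \<open>simp add: \<Delta>_def\<close>)
    moreover have "(\<rho>' s + \<eta>' s) - (\<rho> s + \<eta> s) \<le> 2 * (K * exp (\<mu> * s))"
      by (rule content_difference_le[OF sol' sol s]) (use B in \<open>simp add: \<Delta>_def abs_minus_commute\<close>)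
    \<comment> \<open>Truncation of the content at 1 is 1-Lipschitz.\<close>
    moreover have "\<bar>\<rho> s - \<rho>' s\<bar> \<le> \<bar>(\<rho> s + \<eta> s) - (\<rho>' s + \<eta>' s)\<bar>"
      using busy_eq_min_content[OF sol s] busy_eq_min_content[OF sol' s] by linarith
    moreover have "\<bar>\<Delta> s\<bar> \<le> K * exp (\<mu> * s)" using B[of s] s by simp
    ultimately have "\<bar>y s\<bar> \<le> 3 * (K * exp (\<mu> * s))" using y by linarith
    then show ?thesis by (simp add: mult.assoc)
  qed
  have "\<Delta> t0 = (LINT u:{0..t0}|lebesgue. v u * G (t0 - u))"
  proof -
    have sub: "set_integrable lebesgue {0..T} h \<Longrightarrow> set_integrable lebesgue {0..t0} h" for h :: "real \<Rightarrow> real"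
      using t0 by (auto intro: set_integrable_Icc_subset)
    have "(LINT u:{0..t0}|lebesgue. v u * G (t0 - u))
        = (LINT u:{0..t0}|lebesgue. entry_rate d z1 z2 u * G (t0 - u) - entry_rate d' z1' z2' u * G (t0 - u))"
      by (simp add: v_def left_diff_distrib)
    also have "\<dots> = (LINT u:{0..t0}|lebesgue. entry_rate d z1 z2 u * G (t0 - u))
        - (LINT u:{0..t0}|lebesgue. entry_rate d' z1' z2' u * G (t0 - u))"
      by (intro set_integral_diff(2) set_integrable_mult_cdf(1)[OF G] sub int int')
    finally show ?thesis
      using S(4) S'(4) t0 by (simp add: rate_equations_def \<Delta>_def)
  qed
  also have "\<dots> = (LINT s:{0..t0}|lborel. g s * y (t0 - s))"
    unfolding y_def by (rule set_integral_convolution_cdf[OF G set_integrable_Icc_subset[OF v]]) (use t0 in auto)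
  also have "\<bar>\<dots>\<bar> \<le> cg * (3 * K) * exp (\<mu> * t0) / \<mu>"
  proof (rule convolution_density_bound)
    show "g \<in> borel_measurable borel" "\<And>x. 0 \<le> g x"
      using G by (auto simp: cdf_with_density_def)
    show "continuous_on {0..t0} y"
      unfolding y_def by (rule continuous_on_set_integral[OF set_integrable_Icc_subset[OF v]]) (use t0 in auto)
  qed (use g_le y_le t0 \<mu> in auto)
  also have "\<dots> = K * exp (\<mu> * t0) / 2" using cg by (simp add: \<mu>_def)
  also have "\<dots> = \<bar>\<Delta> t0\<bar> / 2"
    by (simp add: K_def exp_minus field_simps)
  finally have "K = 0" by (simp add: K_def)
  then show ?thesis using \<Delta>_le[OF t] by (simp add: \<Delta>_def)
qed

text \<open>Equal departures give equal contents by the comparison with bound \<open>0\<close>,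
  hence equal \<open>\<rho>\<close> and \<open>\<eta>\<close>. Then the primitives of
  \<open>d\<close> and of the entry rates agree, and so do the integrands a.e. Finally, for
  \<open>0 < \<beta>\<close> the case table determines \<open>z3 * lam\<close>: it is
  \<open>lam\<close> while \<open>\<eta> < \<beta>\<close> and \<open>d\<close> at
  \<open>\<eta> = \<beta>\<close>.\<close>

lemma AE_rates_unique:
  assumes sol: "fluid_solution lam G F \<beta> r0 T \<rho> \<eta> d z1 z2 z3"
    and sol': "fluid_solution lam G F \<beta> r0 T \<rho>' \<eta>' d' z1' z2' z3'"
  shows "AE t\<in>{0..T} in lebesgue. z1 t * lam t + z2 t * d t = z1' t * lam t + z2' t * d' t"
    and "0 < \<beta> \<Longrightarrow> AE t\<in>{0..T} in lebesgue. z3 t * lam t = z3' t * lam t"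
proof -
  note S = fluid_solution_rates[OF sol] and S' = fluid_solution_rates[OF sol']
  note int = controlled_rates_integrable[OF S(1,2)] and int' = controlled_rates_integrable[OF S'(1,2)]
  have sub: "set_integrable lebesgue {0..T} h \<Longrightarrow> t \<le> T \<Longrightarrow> set_integrable lebesgue {0..t} h"
    for h :: "real \<Rightarrow> real" and t
    by (auto intro: set_integrable_Icc_subset)
  have content: "\<rho> t + \<eta> t = \<rho>' t + \<eta>' t" if t: "t \<in> {0..T}" for t
    using content_difference_le[OF sol sol' t, of 0] content_difference_le[OF sol' sol t, of 0]
      departures_unique[OF sol sol'] t by force
  have \<rho>: "\<rho> t = \<rho>' t" if t: "t \<in> {0..T}" for t
    using busy_eq_min_content[OF sol t] busy_eq_min_content[OF sol' t] content[OF t] by simp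
  have \<eta>: "\<eta> t = \<eta>' t" if t: "t \<in> {0..T}" for t
    using content[OF t] \<rho>[OF t] by simp
  have d: "AE t\<in>{0..T} in lebesgue. d t - d' t = 0"
  proof (rule AE_zero_if_interval_integrals_zero[OF set_integral_diff(1)[OF int(1) int'(1)]])
    show "(LINT u:{0..t}|lebesgue. d u - d' u) = 0" if "0 \<le> t" "t \<le> T" for t
      using set_integral_diff(2)[OF sub[OF int(1)] sub[OF int'(1)], of t] departures_unique[OF sol sol', of t] that
      by simp
  qed
  have "AE t\<in>{0..T} in lebesgue. entry_rate d z1 z2 t - entry_rate d' z1' z2' t = 0"
  proof (rule AE_zero_if_interval_integrals_zero[OF set_integral_diff(1)[OF int(5) int'(5)]])
    show "(LINT u:{0..t}|lebesgue. entry_rate d z1 z2 u - entry_rate d' z1' z2' u) = 0" if "0 \<le> t" "t \<le> T" for t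
      using rate_equations_busy[OF S(4) int(5,1) that] rate_equations_busy[OF S'(4) int'(5,1) that]
        set_integral_diff(2)[OF sub[OF int(5)] sub[OF int(1)], of t]
        set_integral_diff(2)[OF sub[OF int'(5)] sub[OF int'(1)], of t]
        set_integral_diff(2)[OF sub[OF int(5)] sub[OF int'(5)], of t]
        \<rho>[of t] departures_unique[OF sol sol', of t] that
      by simp
  qed
  then show "AE t\<in>{0..T} in lebesgue. z1 t * lam t + z2 t * d t = z1' t * lam t + z2' t * d' t"
    by eventually_elim (simp add: entry_rate_def)
  show "AE t\<in>{0..T} in lebesgue. z3 t * lam t = z3' t * lam t" if "0 < \<beta>"
    using AE_case_table[OF sol that] AE_case_table[OF sol' that] d
  proof eventually_elim
    case (elim t)
    show ?case
    proof
      assume t: "t \<in> {0..T}"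
      note E = elim[rule_format, OF t]
      have "z3 t * lam t = (if \<eta> t < \<beta> then lam t else d t)"
        using E(1) that by (auto simp: case_table_def)
      moreover have "z3' t * lam t = (if \<eta>' t < \<beta> then lam t else d' t)"
        using E(2) that by (auto simp: case_table_def)
      ultimately show "z3 t * lam t = z3' t * lam t"
        using E(3) \<eta>[OF t] by simp
    qed
  qed
qed

end

text \<open>The case \<open>\<beta> = 0\<close> is kept apart: then (S4) never forces
  \<open>z3\<close> to be positive, and in idle states \<open>z3\<close> is multiplied by
  \<open>1 - z1 = 0\<close>, so \<open>z3 * lam\<close> is undetermined there. The claim on
  canonical controls is given in both readings: a tuple obeying the table is a solution, and every
  solution can be given such controls without changing \<open>\<rho>\<close>, \<open>\<eta>\<close>
  and \<open>d\<close>.\<close>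

theorem theorem4p2:
  fixes lam G g F f :: "real \<Rightarrow> real" and cg \<beta> r0 T :: real
  assumes "locally_integrable_nonneg lam"
    and "cdf_with_density G g" and "0 < cg" and "\<forall>x. g x \<le> cg"
    and "cdf_with_density F f"
    and "0 \<le> \<beta>" and "0 < r0" and "r0 \<le> 1 + \<beta>"
    and "0 < T"
  shows
    "(\<forall>\<rho> \<eta> d z1 z2 z3. fluid_solution lam G F \<beta> r0 T \<rho> \<eta> d z1 z2 z3 \<longrightarrow>
        (0 < \<beta> \<longrightarrow> (AE t\<in>{0..T} in lebesgue.
            case_table \<beta> (lam t) (\<rho> t) (\<eta> t) (d t) (z1 t) (z2 t) (z3 t))) \<and>
        (\<beta> = 0 \<longrightarrow> (AE t\<in>{0..T} in lebesgue.
            \<rho> t < 1 \<and> \<eta> t = 0 \<longrightarrow> z1 t = 1 \<and> z2 t * d t = 0)))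
     \<and>
     (\<forall>\<rho> \<eta> d z1 z2 z3.
        regular_controls T d z1 z2 z3 \<and>
        integral_equations lam G F r0 T \<rho> \<eta> d z1 z2 z3 \<and>
        control_bounds \<beta> T \<rho> \<eta> z1 z2 z3 \<and>
        (AE t\<in>{0..T} in lebesgue.
            canonical_case_table \<beta> (lam t) (\<rho> t) (\<eta> t) (d t) (z1 t) (z2 t) (z3 t)) \<longrightarrow>
        fluid_solution lam G F \<beta> r0 T \<rho> \<eta> d z1 z2 z3)
     \<and>
     (\<forall>\<rho> \<eta> d z1 z2 z3. fluid_solution lam G F \<beta> r0 T \<rho> \<eta> d z1 z2 z3 \<longrightarrow>
        (\<exists>w1 w2 w3. fluid_solution lam G F \<beta> r0 T \<rho> \<eta> d w1 w2 w3 \<and>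
          (AE t\<in>{0..T} in lebesgue.
            canonical_case_table \<beta> (lam t) (\<rho> t) (\<eta> t) (d t) (w1 t) (w2 t) (w3 t))))
     \<and>
     (\<forall>\<rho> \<eta> d z1 z2 z3 \<rho>' \<eta>' d' z1' z2' z3'.
        fluid_solution lam G F \<beta> r0 T \<rho> \<eta> d z1 z2 z3 \<and>
        fluid_solution lam G F \<beta> r0 T \<rho>' \<eta>' d' z1' z2' z3' \<longrightarrow>
        (AE t\<in>{0..T} in lebesgue.
            z1 t * lam t + z2 t * d t = z1' t * lam t + z2' t * d' t) \<and>
        (0 < \<beta> \<longrightarrow> (AE t\<in>{0..T} in lebesgue. z3 t * lam t = z3' t * lam t)))"
proof -
  interpret fluid_data lam G g F f cg \<beta> r0 T
    using assms by unfold_locales auto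
  show ?thesis
  proof (intro conjI allI impI, goal_cases)
    case 1
    then show ?case by (rule AE_case_table)
  next
    case 2
    from 2(1) show ?case by (rule AE_idle_rates)
  next
    case 3
    then show ?case by (elim conjE) (rule canonical_table_imp_fluid_solution)
  next
    case 4
    then show ?case by (rule ex_canonical_controls)
  next
    case 5
    then show ?case by (elim conjE) (rule AE_rates_unique(1))
  next
    case 6
    from 6(1) show ?case by (elim conjE) (rule AE_rates_unique(2)[OF _ _ 6(2)])
  qed
qed

end
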